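(* Let $\alpha$ be a positive, non-decreasing function. If there is an $\alpha(n)$-approximation for maximizing a monotone DR-submodular function on a distributive lattice subject to a $0$-$1$-knapsack constraint, then there is a $2\alpha(n'(m'+1))$-approximation for the densest $k$-subhypergraph problem. Here $n$ denotes the number of elements of the poset defining the distributive lattice, and $n'$, $m'$ denote the numbers of vertices and hyperedges of the input hypergraph.
   Context: For a finite poset $P=(\mathcal{N},\preceq)$, an ideal is a set $S\subseteq\mathcal{N}$ such that $s\in S$ and $t\preceq s$ imply $t\in S$; $\mathcal{D}(P)$ is the set of all ideals of $P$, a distributive lattice under union and intersection; a distributive lattice is always given by such a poset $P$. Write $S+x=S\cup\{x\}$. A function $f:\mathcal{D}(P)\to\mathbb{R}_+$ is DR-submodular if $f(S+x)-f(S)\ge f(T+y)-f(T)$ for all $S,T\in\mathcal{D}(P)$ with $S\subseteq T$ and all $x\preceq y$ with $x\notin S$, $y\notin T$, $S+x,T+y\in\mathcal{D}(P)$. It is monotone if $f(S)\le f(T)$ whenever $S\subseteq T$. Maximizing a monotone DR-submodular function on a distributive lattice subject to a $0$-$1$-knapsack constraint: given a finite poset $P=(\mathcal{N},\preceq)$ with $n=|\mathcal{N}|$, a value oracle for a monotone DR-submodular $f:\mathcal{D}(P)\to\mathbb{R}_+$, weights $w:\mathcal{N}\to\{0,1\}$ and a budget $B$, find $S\in\mathcal{D}(P)$ with $w(S)=\sum_{s\in S}w(s)\le B$ maximizing $f(S)$. Densest $k$-subhypergraph problem: given a hypergraph $H=(V,E)$ with $n'=|V|$, $m'=|E|$ and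 $k\in\mathbb{N}$ with $k\le|V|$, choose $k$ vertices such that the number of induced hyperedges (hyperedges contained in the chosen vertex set) is maximized. For a maximization problem, an $\alpha$-approximation (with $\alpha$ a function of the input size) is a polynomial-time algorithm (counting oracle calls as single steps) that always returns a feasible solution of value at least $\frac1\alpha$ times the optimal value. *)

theory Defs
  imports Complex_Main "HOL-Computational_Algebra.Polynomial"
begin

section \<open>Ideals and DR-submodular functions\<close>

text \<open>A pair \<open>(t, s)\<close> in \<open>r\<close> means that \<open>t\<close> is below \<open>s\<close>.\<close>

definition ideals :: "'a set \<Rightarrow> ('a \<times> 'a) set \<Rightarrow> 'a set set" where
  "ideals N r = {S. S \<subseteq> N \<and> (\<forall>s\<in>S. \<forall>t. (t, s) \<in> r \<longrightarrow> t \<in> S)}"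

definition DR_submodular :: "'a set \<Rightarrow> ('a \<times> 'a) set \<Rightarrow> ('a set \<Rightarrow> real) \<Rightarrow> bool" where
  "DR_submodular N r f \<longleftrightarrow>
    (\<forall>S\<in>ideals N r. \<forall>T\<in>ideals N r. \<forall>x y.
       S \<subseteq> T \<and> (x, y) \<in> r \<and> x \<notin> S \<and> y \<notin> T \<and>
       insert x S \<in> ideals N r \<and> insert y T \<in> ideals N r \<longrightarrow>
       f (insert x S) - f S \<ge> f (insert y T) - f T)"

definition monotone_ideals :: "'a set \<Rightarrow> ('a \<times> 'a) set \<Rightarrow> ('a set \<Rightarrow> real) \<Rightarrow> bool" where
  "monotone_ideals N r f \<longleftrightarrow>
    (\<forall>S\<in>ideals N r. \<forall>T\<in>ideals N r. S \<subseteq> T \<longrightarrow> f S \<le> f T)"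

definition knapsack_instance ::
  "'a set \<Rightarrow> ('a \<times> 'a) set \<Rightarrow> ('a set \<Rightarrow> real) \<Rightarrow> ('a \<Rightarrow> nat) \<Rightarrow> bool" where
  "knapsack_instance N r f w \<longleftrightarrow>
     finite N \<and> partial_order_on N r \<and>
     (\<forall>S\<in>ideals N r. f S \<ge> 0) \<and> monotone_ideals N r f \<and> DR_submodular N r f \<and>
     (\<forall>x\<in>N. w x \<in> {0, 1})"

definition knapsack_feasible ::
  "'a set \<Rightarrow> ('a \<times> 'a) set \<Rightarrow> ('a \<Rightarrow> nat) \<Rightarrow> nat \<Rightarrow> 'a set set" where
  "knapsack_feasible N r w B = {S \<in> ideals N r. (\<Sum>s\<in>S. w s) \<le> B}"


section \<open>Hypergraphs\<close>

definition hypergraph :: "'a set \<Rightarrow> 'a set set \<Rightarrow> bool" where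
  "hypergraph V E \<longleftrightarrow> finite V \<and> E \<subseteq> Pow V"

definition induced_edges :: "'a set set \<Rightarrow> 'a set \<Rightarrow> 'a set set" where
  "induced_edges E U = {e \<in> E. e \<subseteq> U}"

definition subhypergraph_feasible :: "'a set \<Rightarrow> nat \<Rightarrow> 'a set set" where
  "subhypergraph_feasible V k = {U. U \<subseteq> V \<and> card U = k}"


section \<open>Approximate solutions of a maximization problem\<close>

text \<open>The maximum is taken only over sets \<open>F\<close> that are finite and nonempty; see
  \<open>feasible_finite_nonempty\<close> below.\<close>

definition approx_solution :: "real \<Rightarrow> 's set \<Rightarrow> ('s \<Rightarrow> real) \<Rightarrow> 's \<Rightarrow> bool" where
  "approx_solution \<rho> F val S \<longleftrightarrow> S \<in> F \<and> val S \<ge> 1 / \<rho> * Max (val ` F)"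

lemma finite_ideals: "finite N \<Longrightarrow> finite (ideals N r)"
  by (rule finite_subset[of _ "Pow N"]) (auto simp: ideals_def)

lemma feasible_finite_nonempty:
  "finite N \<Longrightarrow> finite (knapsack_feasible N r w B)"
  "{} \<in> knapsack_feasible N r w B"
  "finite V \<Longrightarrow> finite (subhypergraph_feasible V k)"
  "k \<le> card V \<Longrightarrow> subhypergraph_feasible V k \<noteq> {}"
proof -
  show "finite N \<Longrightarrow> finite (knapsack_feasible N r w B)"
    by (simp add: knapsack_feasible_def finite_ideals)
  show "{} \<in> knapsack_feasible N r w B"
    by (simp add: knapsack_feasible_def ideals_def)
  show "finite V \<Longrightarrow> finite (subhypergraph_feasible V k)"
    by (simp add: subhypergraph_feasible_def)
  show "k \<le> card V \<Longrightarrow> subhypergraph_feasible V k \<noteq> {}"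
    using obtain_subset_with_card_n[of k V] by (auto simp: subhypergraph_feasible_def)
qed


section \<open>Oracle programs and their running time\<close>

text \<open>The model of computation is Jones' language WHILE: imperative programs over binary
  trees, extended by an instruction that queries an oracle.  The size of a tree is its number of
  inner nodes.  Evaluating an expression costs the sizes of all values that occur in the
  evaluation, so that no sharing of subtrees is presupposed, and polynomial time in this
  model is the same as polynomial time on Turing machines.  An oracle call is a single step,
  whatever the size of the query and of the answer.\<close>

datatype data = Leaf | Node data data

datatype exp = Nil_exp | Var nat | Cons_exp exp exp | Hd exp | Tl exp | Eq exp exp

datatype com =
    Skip
  | Assign nat exp
  | Query nat nat
  | Seq com com
  | Cond exp com com
  | While exp com

type_synonym state = "nat \<Rightarrow> data"

fun hd_data :: "data \<Rightarrow> data" where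
  "hd_data Leaf = Leaf"
| "hd_data (Node a b) = a"

fun tl_data :: "data \<Rightarrow> data" where
  "tl_data Leaf = Leaf"
| "tl_data (Node a b) = b"

definition enc_bool :: "bool \<Rightarrow> data" where
  "enc_bool b = (if b then Node Leaf Leaf else Leaf)"

fun eval_exp :: "exp \<Rightarrow> state \<Rightarrow> data" where
  "eval_exp Nil_exp s = Leaf"
| "eval_exp (Var x) s = s x"
| "eval_exp (Cons_exp a b) s = Node (eval_exp a s) (eval_exp b s)"
| "eval_exp (Hd a) s = hd_data (eval_exp a s)"
| "eval_exp (Tl a) s = tl_data (eval_exp a s)"
| "eval_exp (Eq a b) s = enc_bool (eval_exp a s = eval_exp b s)"

fun subexps :: "exp \<Rightarrow> exp list" where
  "subexps (Cons_exp a b) = Cons_exp a b # subexps a @ subexps b"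
| "subexps (Hd a) = Hd a # subexps a"
| "subexps (Tl a) = Tl a # subexps a"
| "subexps (Eq a b) = Eq a b # subexps a @ subexps b"
| "subexps a = [a]"

definition cost :: "exp \<Rightarrow> state \<Rightarrow> nat" where
  "cost e s = (\<Sum>a\<leftarrow>subexps e. Suc (size (eval_exp a s)))"

text \<open>\<open>exec Or c s t s'\<close>: with oracle \<open>Or\<close>, program \<open>c\<close> started in state \<open>s\<close> terminates in state
  \<open>s'\<close> after time \<open>t\<close>.  In tests, every tree other than \<open>Leaf\<close> counts as true.\<close>

inductive exec :: "(data \<Rightarrow> data) \<Rightarrow> com \<Rightarrow> state \<Rightarrow> nat \<Rightarrow> state \<Rightarrow> bool"
  for Or :: "data \<Rightarrow> data" where
  exec_Skip: "exec Or Skip s 1 s"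
| exec_Assign: "exec Or (Assign x e) s (Suc (cost e s)) (s(x := eval_exp e s))"
| exec_Query: "exec Or (Query x y) s 1 (s(x := Or (s y)))"
| exec_Seq: "\<lbrakk>exec Or c s t s'; exec Or d s' u s''\<rbrakk> \<Longrightarrow> exec Or (Seq c d) s (t + u) s''"
| exec_CondT: "\<lbrakk>eval_exp e s \<noteq> Leaf; exec Or c s t s'\<rbrakk>
    \<Longrightarrow> exec Or (Cond e c d) s (Suc (cost e s + t)) s'"
| exec_CondF: "\<lbrakk>eval_exp e s = Leaf; exec Or d s t s'\<rbrakk>
    \<Longrightarrow> exec Or (Cond e c d) s (Suc (cost e s + t)) s'"
| exec_WhileF: "eval_exp e s = Leaf \<Longrightarrow> exec Or (While e c) s (Suc (cost e s)) s"
| exec_WhileT: "\<lbrakk>eval_exp e s \<noteq> Leaf; exec Or c s t s'; exec Or (While e c) s' u s''\<rbrakk>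
    \<Longrightarrow> exec Or (While e c) s (Suc (cost e s + t + u)) s''"

inductive_cases exec_SkipE: "exec Or Skip s t s'"
inductive_cases exec_AssignE: "exec Or (Assign x e) s t s'"
inductive_cases exec_QueryE: "exec Or (Query x y) s t s'"
inductive_cases exec_SeqE: "exec Or (Seq c d) s t s'"
inductive_cases exec_CondE: "exec Or (Cond e c d) s t s'"
inductive_cases exec_WhileE: "exec Or (While e c) s t s'"

lemma exec_deterministic:
  "exec Or c s t s' \<Longrightarrow> exec Or c s u s'' \<Longrightarrow> u = t \<and> s'' = s'"
proof (induction arbitrary: u s'' rule: exec.induct)
  case (exec_Seq c s t s' d t' s1)
  from exec_Seq.prems show ?case
    by (rule exec_SeqE) (use exec_Seq.IH in blast)
next
  case (exec_WhileT e s c t s' t' s1)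
  from exec_WhileT.prems show ?case
    by (rule exec_WhileE) (use exec_WhileT.IH exec_WhileT.hyps in blast)+
next
  case (exec_CondT e s c t s' d)
  from exec_CondT.prems show ?case
    by (rule exec_CondE) (use exec_CondT.IH exec_CondT.hyps in blast)+
next
  case (exec_CondF e s d t s' c)
  from exec_CondF.prems show ?case
    by (rule exec_CondE) (use exec_CondF.IH exec_CondF.hyps in blast)+
next
  case (exec_WhileF e s c)
  from exec_WhileF.prems show ?case
    by (rule exec_WhileE) (use exec_WhileF.hyps in blast)+
qed (auto elim: exec_SkipE exec_AssignE exec_QueryE)

fun oracle_free :: "com \<Rightarrow> bool" where
  "oracle_free (Query x y) \<longleftrightarrow> False"
| "oracle_free (Seq c d) \<longleftrightarrow> oracle_free c \<and> oracle_free d"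
| "oracle_free (Cond e c d) \<longleftrightarrow> oracle_free c \<and> oracle_free d"
| "oracle_free (While e c) \<longleftrightarrow> oracle_free c"
| "oracle_free c \<longleftrightarrow> True"

text \<open>Variable 0 holds the input at the start and the output at the end.\<close>

definition computes :: "(data \<Rightarrow> data) \<Rightarrow> com \<Rightarrow> data \<Rightarrow> nat \<Rightarrow> data \<Rightarrow> bool" where
  "computes Or c inp t out \<longleftrightarrow> (\<exists>s. exec Or c ((\<lambda>_. Leaf)(0 := inp)) t s \<and> s 0 = out)"


section \<open>Encodings\<close>

fun enc_list :: "data list \<Rightarrow> data" where
  "enc_list [] = Leaf"
| "enc_list (d # ds) = Node d (enc_list ds)"

text \<open>Binary notation, least significant bit first, without superfluous zeros.\<close>

fun enc_nat :: "nat \<Rightarrow> data" where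
  "enc_nat n = (if n = 0 then Leaf else Node (enc_bool (odd n)) (enc_nat (n div 2)))"

declare enc_nat.simps [simp del]

text \<open>A subset of \<open>{..<n}\<close> is given by its characteristic vector.\<close>

definition enc_set :: "nat \<Rightarrow> nat set \<Rightarrow> data" where
  "enc_set n S = enc_list (map (\<lambda>i. enc_bool (i \<in> S)) [0..<n])"

text \<open>Function values are handed to a program as reduced fractions in binary notation.\<close>

definition encodes_value :: "data \<Rightarrow> real \<Rightarrow> bool" where
  "encodes_value d v \<longleftrightarrow>
    (\<exists>p q. q > 0 \<and> coprime p q \<and> v = real p / real q \<and> d = Node (enc_nat p) (enc_nat q))"

lemma enc_list_inj: "enc_list xs = enc_list ys \<Longrightarrow> xs = ys"
proof (induction xs arbitrary: ys)
  case Nil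
  then show ?case by (cases ys) auto
next
  case (Cons x xs)
  then show ?case by (cases ys) auto
qed

lemma enc_bool_inj: "enc_bool a = enc_bool b \<longleftrightarrow> a = b"
  by (simp add: enc_bool_def)

lemma enc_set_inj:
  assumes "S \<subseteq> {..<n}" "T \<subseteq> {..<n}" "enc_set n S = enc_set n T"
  shows "S = T"
proof -
  have "\<forall>i<n. i \<in> S \<longleftrightarrow> i \<in> T"
    using enc_list_inj[OF assms(3)[unfolded enc_set_def]] by (simp add: enc_bool_inj)
  with assms(1,2) show ?thesis by blast
qed

lemma enc_nat_inj: "enc_nat m = enc_nat n \<Longrightarrow> m = n"
proof (induction m arbitrary: n rule: less_induct)
  case (less m)
  show ?case
  proof (cases "m = 0 \<or> n = 0")
    case True
    with less.prems show ?thesis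
      by (auto simp: enc_nat.simps[of m] enc_nat.simps[of n] split: if_splits)
  next
    case False
    with less.prems have "odd m = odd n" "enc_nat (m div 2) = enc_nat (n div 2)"
      by (auto simp: enc_nat.simps[of m] enc_nat.simps[of n] enc_bool_inj)
    moreover from this(2) have "m div 2 = n div 2"
      using less.IH[of "m div 2"] False by simp
    ultimately show ?thesis
      by (metis odd_iff_mod_2_eq_one even_iff_mod_2_eq_zero mult_div_mod_eq)
  qed
qed


section \<open>Approximation algorithms for the two problems\<close>

text \<open>An instance given to a program has the ground set \<open>{..<n}\<close>.  The order is passed as the list
  of the principal ideals of the elements.\<close>

definition enc_knapsack :: "nat \<Rightarrow> (nat \<times> nat) set \<Rightarrow> (nat \<Rightarrow> nat) \<Rightarrow> nat \<Rightarrow> data" where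
  "enc_knapsack n r w B =
     Node (enc_list (map (\<lambda>x. enc_set n {y. (y, x) \<in> r}) [0..<n]))
       (Node (enc_list (map (\<lambda>x. enc_nat (w x)) [0..<n])) (enc_nat B))"

text \<open>Nothing is required of an oracle on queries that do not encode an ideal.  Since answers are
  finite data, only functions with rational values have a value oracle.\<close>

definition value_oracle ::
  "nat \<Rightarrow> (nat \<times> nat) set \<Rightarrow> (nat set \<Rightarrow> real) \<Rightarrow> (data \<Rightarrow> data) \<Rightarrow> bool" where
  "value_oracle n r f Or \<longleftrightarrow>
     (\<forall>S\<in>ideals {..<n} r. encodes_value (Or (enc_set n S)) (f S))"

definition max_answer_size :: "nat \<Rightarrow> (nat \<times> nat) set \<Rightarrow> (data \<Rightarrow> data) \<Rightarrow> nat" where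
  "max_answer_size n r Or = Max ((\<lambda>S. size (Or (enc_set n S))) ` ideals {..<n} r)"

text \<open>The size of the function values counts towards the input size: the running time is
  polynomial in the size of the explicit input and the bit length of the values of \<open>f\<close>.\<close>

definition knapsack_approximation :: "com \<Rightarrow> (nat \<Rightarrow> real) \<Rightarrow> bool" where
  "knapsack_approximation c \<rho> \<longleftrightarrow>
    (\<exists>p :: nat poly. \<forall>n r f w B Or.
       knapsack_instance {..<n} r f w \<and> value_oracle n r f Or \<longrightarrow>
       (\<exists>t S. computes Or c (enc_knapsack n r w B) t (enc_set n S) \<and>
              t \<le> poly p (size (enc_knapsack n r w B) + max_answer_size n r Or) \<and>
              approx_solution (\<rho> n) (knapsack_feasible {..<n} r w B) f S))"

text \<open>The hyperedges come as a list, in arbitrary order and without repetition.  The vertex set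
  is written out, so that the input size is at least the number of vertices even if there are no
  hyperedges.\<close>

definition enc_hypergraph :: "nat \<Rightarrow> nat set list \<Rightarrow> nat \<Rightarrow> data" where
  "enc_hypergraph n es k =
     Node (enc_set n {..<n}) (Node (enc_list (map (enc_set n) es)) (enc_nat k))"

text \<open>As \<open>c\<close> contains no queries, the oracle in the following definition is irrelevant.\<close>

definition densest_subhypergraph_approximation :: "com \<Rightarrow> (nat \<Rightarrow> nat \<Rightarrow> real) \<Rightarrow> bool" where
  "densest_subhypergraph_approximation c \<rho> \<longleftrightarrow>
    oracle_free c \<and>
    (\<exists>p :: nat poly. \<forall>n E es k.
       hypergraph {..<n} E \<and> set es = E \<and> distinct es \<and> k \<le> n \<longrightarrow>
       (\<exists>t U. computes (\<lambda>_. Leaf) c (enc_hypergraph n es k) t (enc_set n U) \<and>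
              t \<le> poly p (size (enc_hypergraph n es k)) \<and>
              approx_solution (\<rho> n (card E)) (subhypergraph_feasible {..<n} k)
                (\<lambda>U. real (card (induced_edges E U))) U))"

end

theory Submission
  imports Defs
begin

text \<open>Given a hypergraph, take its vertices, of weight 1, as minimal elements of a poset, and put
  \<open>n'\<close> copies of every hyperedge, of weight 0, above the vertices of that hyperedge.  Cardinality
  is a monotone DR-submodular function on the ideals, and a best ideal with vertex set \<open>U\<close> has
  \<open>card U + n' * e(U)\<close> elements, where \<open>e(U)\<close> is the number of hyperedges induced by \<open>U\<close>.
  As \<open>card U \<le> k \<le> n'\<close>, the first summand costs at most a factor 2 as soon as \<open>e(U) \<ge> 1\<close>.
  If \<open>e(U) = 0\<close>, then the optimum is at most \<open>\<alpha>\<close>, and any single hyperedge with at most \<open>k\<close>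
  vertices is good enough.

  To see that the reduction runs in polynomial time, polynomial-time functions on trees are
  shown to be closed under composition, pairing, case distinction and bounded iteration over
  lists.  The oracle queries of the given program are replaced by a subroutine that computes
  cardinalities.\<close>

section \<open>Polynomial-time functions on trees\<close>

text \<open>The budget charges only vertices, so an ideal takes for free every hyperedge copy whose
  vertices it has paid for; the hardness sits in the lattice and the objective can be modular. The
  objective also counts the paid vertices, though, so a multiplicative guarantee for
  \<open>k + n * e\<close> need not give one for \<open>e\<close>. Having as many copies as vertices
  makes a single induced hyperedge count at least as much as all chosen vertices. With
  \<open>n = 0\<close> there are no copies, although the empty hyperedge may be present; there the
  bound rests on the fact that no approximation factor is below 1. On the machine side, the given
  program is a black box known only through its runs with an oracle. A query costs one step, whereas
  the subroutine replacing it pays for the size of its argument, so all values occurring in a run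
  must be bounded. Reduction and postprocessing are total functions on trees that have to be right
  on encodings only.\<close>

definition growth :: "(nat \<Rightarrow> nat) \<Rightarrow> bool" where
  "growth q \<longleftrightarrow> (\<exists>p :: nat poly. q = poly p)"

lemma growth_const: "growth (\<lambda>_. k)"
  unfolding growth_def by (rule exI[of _ "[:k:]"]) auto

lemma growth_id: "growth (\<lambda>n. n)"
  unfolding growth_def by (rule exI[of _ "[:0, 1:]"]) auto

lemma growth_add: "growth q \<Longrightarrow> growth r \<Longrightarrow> growth (\<lambda>n. q n + r n)"
  by (auto simp: growth_def fun_eq_iff) (metis poly_add)

lemma growth_mult: "growth q \<Longrightarrow> growth r \<Longrightarrow> growth (\<lambda>n. q n * r n)"
  by (auto simp: growth_def fun_eq_iff) (metis poly_mult)

lemma growth_compose: "growth q \<Longrightarrow> growth r \<Longrightarrow> growth (\<lambda>n. q (r n))"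
  by (auto simp: growth_def fun_eq_iff) (metis poly_pcompose)

lemma growth_Suc: "growth q \<Longrightarrow> growth (\<lambda>n. Suc (q n))"
  using growth_add[OF growth_const[of 1]] by simp

lemmas growth_intros = growth_const growth_id growth_Suc growth_add growth_mult

text \<open>Coefficients in \<open>nat\<close> are nonnegative; this lets a size be replaced by any
  upper bound inside a running time.\<close>

lemma growth_mono:
  assumes "growth q" "m \<le> n"
  shows "q m \<le> q n"
proof -
  obtain p where p: "q = poly p"
    using assms by (auto simp: growth_def)
  have "poly p m \<le> poly p n"
    using \<open>m \<le> n\<close> by (induction p) (auto intro!: add_mono mult_mono)
  with p show ?thesis by simp
qed

section \<open>Time-bounded total correctness\<close>

definition runs :: "com \<Rightarrow> state \<Rightarrow> nat \<Rightarrow> (state \<Rightarrow> bool) \<Rightarrow> bool" where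
  "runs c s T Q \<longleftrightarrow> (\<exists>t s'. exec (\<lambda>_. Leaf) c s t s' \<and> t \<le> T \<and> Q s')"

lemma runsI: "exec (\<lambda>_. Leaf) c s t s' \<Longrightarrow> t \<le> T \<Longrightarrow> Q s' \<Longrightarrow> runs c s T Q"
  by (auto simp: runs_def)

lemma runsE:
  assumes "runs c s T Q"
  obtains t s' where "exec (\<lambda>_. Leaf) c s t s'" "t \<le> T" "Q s'"
  using assms by (auto simp: runs_def)

lemma runs_mono:
  assumes "runs c s T Q" "T \<le> T'" "\<And>s'. Q s' \<Longrightarrow> Q' s'"
  shows "runs c s T' Q'"
  using assms(1) by (rule runsE) (rule runsI, assumption, use assms(2,3) in auto)

lemma runs_Assign:
  "Suc (cost e s) \<le> T \<Longrightarrow> Q (s(x := eval_exp e s)) \<Longrightarrow> runs (Assign x e) s T Q"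
  by (rule runsI[OF exec_Assign])

text \<open>The postcondition of the first run is itself a \<open>runs\<close> statement, so
  programs are verified in weakest-precondition style while the time bounds add up.\<close>

lemma runs_Seq:
  assumes "runs c s T (\<lambda>s'. runs d s' U Q)"
  shows "runs (Seq c d) s (T + U) Q"
  using assms by (elim runsE) (rule runsI[OF exec_Seq], auto)

lemma runs_Cond:
  assumes "runs (if eval_exp e s = Leaf then d else c) s T Q"
  shows "runs (Cond e c d) s (Suc (cost e s + T)) Q"
proof -
  obtain t s' where "exec (\<lambda>_. Leaf) (if eval_exp e s = Leaf then d else c) s t s'" "t \<le> T" "Q s'"
    using assms by (auto simp: runs_def)
  moreover from this(1) have "exec (\<lambda>_. Leaf) (Cond e c d) s (Suc (cost e s + t)) s'"
    by (auto intro: exec_CondT exec_CondF split: if_splits)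
  ultimately show ?thesis
    unfolding runs_def by (intro exI[of _ "Suc (cost e s + t)"] exI[of _ s']) auto
qed

lemma runs_WhileF:
  "eval_exp e s = Leaf \<Longrightarrow> Q s \<Longrightarrow> runs (While e c) s (Suc (cost e s)) Q"
  by (rule runsI[OF exec_WhileF]) auto

lemma runs_WhileT:
  assumes "eval_exp e s \<noteq> Leaf" "runs c s T (\<lambda>s'. runs (While e c) s' U Q)"
  shows "runs (While e c) s (Suc (cost e s + T + U)) Q"
  using assms(2) by (elim runsE) (rule runsI[OF exec_WhileT[OF assms(1)]], auto)

text \<open>A stack discipline for variables: \<open>b\<close> is argument and result, the variables
  above it are scratch, those below survive. Nothing is assumed about the initial scratch values, so
  \<open>c\<close> can be run repeatedly in a loop.\<close>

definition implements :: "com \<Rightarrow> nat \<Rightarrow> (data \<Rightarrow> data) \<Rightarrow> (nat \<Rightarrow> nat) \<Rightarrow> bool" where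
  "implements c b f q \<longleftrightarrow> oracle_free c \<and>
     (\<forall>s. runs c s (q (size (s b))) (\<lambda>s'. s' b = f (s b) \<and> (\<forall>x<b. s' x = s x)))"

lemma implementsD:
  assumes "implements c b f q" "size (s b) \<le> n" "growth q"
    and "\<And>s'. s' b = f (s b) \<Longrightarrow> (\<And>x. x < b \<Longrightarrow> s' x = s x) \<Longrightarrow> Q s'"
  shows "runs c s (q n) Q"
proof -
  have "runs c s (q (size (s b))) (\<lambda>s'. s' b = f (s b) \<and> (\<forall>x<b. s' x = s x))"
    using assms(1) by (simp add: implements_def)
  then show ?thesis
    by (rule runs_mono) (use assms growth_mono in auto)
qed

text \<open>One bound \<open>q\<close> serves for both time and output size, and it does not depend
  on \<open>b\<close>: moving a program to other variables costs nothing.\<close>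

definition ptime :: "(data \<Rightarrow> data) \<Rightarrow> bool" where
  "ptime f \<longleftrightarrow> (\<exists>q. growth q \<and> (\<forall>d. size (f d) \<le> q (size d)) \<and> (\<forall>b. \<exists>c. implements c b f q))"

lemma ptimeE:
  assumes "ptime f"
  obtains q C where "growth q" "\<And>d. size (f d) \<le> q (size d)" "\<And>b. implements (C b) b f q"
  using assms unfolding ptime_def by metis

lemma cost_simps [simp]:
  "cost Nil_exp s = 1"
  "cost (Var x) s = Suc (size (s x))"
  "cost (Cons_exp e e') s = Suc (size (eval_exp (Cons_exp e e') s)) + cost e s + cost e' s"
  "cost (Hd e) s = Suc (size (eval_exp (Hd e) s)) + cost e s"
  "cost (Tl e) s = Suc (size (eval_exp (Tl e) s)) + cost e s"
  "cost (Eq e e') s = Suc (size (eval_exp (Eq e e') s)) + cost e s + cost e' s"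
  by (simp_all add: cost_def)

lemma size_hd [simp]: "size (hd_data d) \<le> size d"
  by (cases d) auto

lemma size_tl [simp]: "size (tl_data d) \<le> size d"
  by (cases d) auto

lemma size_enc_bool: "size (enc_bool b) \<le> 1"
  by (simp add: enc_bool_def)

lemma ptime_id: "ptime (\<lambda>d. d)"
  unfolding ptime_def
proof (intro exI[of _ "\<lambda>n. Suc n"] conjI allI)
  fix b :: nat
  show "\<exists>c. implements c b (\<lambda>d. d) Suc"
    by (rule exI[of _ Skip]) (auto simp: implements_def intro: runsI[OF exec_Skip])
qed (auto intro!: growth_intros)

lemma ptime_compose:
  assumes f: "ptime f" and g: "ptime g"
  shows "ptime (\<lambda>d. f (g d))"
proof -
  obtain qf F where f: "growth qf" "\<And>d. size (f d) \<le> qf (size d)" "\<And>b. implements (F b) b f qf"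
    by (rule ptimeE[OF f]) (rule that)
  obtain qg G where g: "growth qg" "\<And>d. size (g d) \<le> qg (size d)" "\<And>b. implements (G b) b g qg"
    by (rule ptimeE[OF g]) (rule that)
  show ?thesis
    unfolding ptime_def
  proof (intro exI[of _ "\<lambda>n. qg n + qf (qg n)"] conjI allI)
    show "growth (\<lambda>n. qg n + qf (qg n))"
      by (intro growth_intros growth_compose[OF f(1)] g(1))
    show "size (f (g d)) \<le> qg (size d) + qf (qg (size d))" for d
      using f(2)[of "g d"] growth_mono[OF f(1) g(2)[of d]] by linarith
    fix b
    have "oracle_free (Seq (G b) (F b))"
      using f(3)[of b] g(3)[of b] by (simp add: implements_def)
    then show "\<exists>c. implements c b (\<lambda>d. f (g d)) (\<lambda>n. qg n + qf (qg n))"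
      unfolding implements_def
      by (intro exI[of _ "Seq (G b) (F b)"] conjI allI runs_Seq implementsD[OF g(3) _ g(1)]
          implementsD[OF f(3) _ f(1)]) (auto simp: g(2))
  qed
qed

text \<open>Common scheme for all one-expression operations: the input stays in \<open>b\<close>
  while both arguments are computed above it. The factor 10 is generous; a constructor or an
  equality test on two variables costs at most twice their sizes plus a small constant.\<close>

lemma ptime_exp:
  assumes f: "ptime f" and g: "ptime g"
    and h: "\<And>b s. eval_exp (e b) s = h (s (Suc b)) (s (Suc (Suc b)))"
    and c: "\<And>b s. cost (e b) s \<le> 10 * (Suc (size (s (Suc b)) + size (s (Suc (Suc b)))))"
    and sz: "\<And>x y. size (h x y) \<le> Suc (size x + size y)"
  shows "ptime (\<lambda>d. h (f d) (g d))"
proof -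
  obtain qf F where f: "growth qf" "\<And>d. size (f d) \<le> qf (size d)" "\<And>b. implements (F b) b f qf"
    by (rule ptimeE[OF f]) (rule that)
  obtain qg G where g: "growth qg" "\<And>d. size (g d) \<le> qg (size d)" "\<And>b. implements (G b) b g qg"
    by (rule ptimeE[OF g]) (rule that)
  let ?q = "\<lambda>n. (2 + n) + (qf n + ((2 + n) + (qg n + (11 + 10 * qf n + 10 * qg n))))"
  let ?c = "\<lambda>b. Seq (Assign (Suc b) (Var b)) (Seq (F (Suc b)) (Seq (Assign (Suc (Suc b)) (Var b))
     (Seq (G (Suc (Suc b))) (Assign b (e b)))))"
  show ?thesis
    unfolding ptime_def
  proof (intro exI[of _ ?q] conjI allI)
    show "growth ?q"
      by (intro growth_intros f(1) g(1))
    show "size (h (f d) (g d)) \<le> ?q (size d)" for d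
      using f(2)[of d] g(2)[of d] sz[of "f d" "g d"] by simp
    fix b
    have "oracle_free (?c b)"
      using f(3)[of "Suc b"] g(3)[of "Suc (Suc b)"] by (simp add: implements_def)
    moreover have "runs (?c b) s (?q (size (s b))) (\<lambda>s'. s' b = h (f (s b)) (g (s b)) \<and> (\<forall>x<b. s' x = s x))" for s
      by (intro runs_Seq runs_Assign implementsD[OF g(3) _ g(1)] implementsD[OF f(3) _ f(1)])
        (use f(2)[of "s b"] g(2)[of "s b"] in \<open>auto simp: h intro!: order_trans[OF c]\<close>)
    ultimately show "\<exists>c. implements c b (\<lambda>d. h (f d) (g d)) ?q"
      unfolding implements_def by blast
  qed
qed

lemma ptime_Leaf: "ptime (\<lambda>_. Leaf)"
  using ptime_exp[OF ptime_id ptime_id, of "\<lambda>_. Nil_exp" "\<lambda>_ _. Leaf"] by simp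

lemma ptime_Node: "ptime f \<Longrightarrow> ptime g \<Longrightarrow> ptime (\<lambda>d. Node (f d) (g d))"
  by (rule ptime_exp[where e = "\<lambda>b. Cons_exp (Var (Suc b)) (Var (Suc (Suc b)))"]) auto

lemma ptime_const: "ptime (\<lambda>_. k)"
  by (induction k) (auto intro: ptime_Leaf ptime_Node)

lemma ptime_hd: "ptime f \<Longrightarrow> ptime (\<lambda>d. hd_data (f d))"
  by (rule ptime_exp[where e = "\<lambda>b. Hd (Var (Suc b))" and h = "\<lambda>x y. hd_data x" and g = f])
    (auto intro: order_trans[OF size_hd])

lemma ptime_tl: "ptime f \<Longrightarrow> ptime (\<lambda>d. tl_data (f d))"
  by (rule ptime_exp[where e = "\<lambda>b. Tl (Var (Suc b))" and h = "\<lambda>x y. tl_data x" and g = f])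
    (auto intro: order_trans[OF size_tl])

lemma ptime_eq:
  assumes "ptime f" "ptime g"
  shows "ptime (\<lambda>d. enc_bool (f d = g d))"
  by (rule ptime_exp[OF assms, where e = "\<lambda>b. Eq (Var (Suc b)) (Var (Suc (Suc b)))"
        and h = "\<lambda>x y. enc_bool (x = y)"]) (auto simp: enc_bool_def)

lemma ptime_if_Leaf:
  assumes p: "ptime p" and f: "ptime f" and g: "ptime g"
  shows "ptime (\<lambda>d. if p d = Leaf then f d else g d)"
proof -
  obtain qp P where p: "growth qp" "\<And>d. size (p d) \<le> qp (size d)" "\<And>b. implements (P b) b p qp"
    by (rule ptimeE[OF p]) (rule that)
  obtain qf F where f: "growth qf" "\<And>d. size (f d) \<le> qf (size d)" "\<And>b. implements (F b) b f qf"
    by (rule ptimeE[OF f]) (rule that)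
  obtain qg G where g: "growth qg" "\<And>d. size (g d) \<le> qg (size d)" "\<And>b. implements (G b) b g qg"
    by (rule ptimeE[OF g]) (rule that)
  let ?q = "\<lambda>n. (2 + n) + (qp n + (2 + qp n + (qf n + qg n)))"
  let ?c = "\<lambda>b. Seq (Assign (Suc b) (Var b)) (Seq (P (Suc b)) (Cond (Var (Suc b)) (G b) (F b)))"
  show ?thesis
    unfolding ptime_def
  proof (intro exI[of _ ?q] conjI allI)
    show "growth ?q"
      by (intro growth_intros p(1) f(1) g(1))
    show "size (if p d = Leaf then f d else g d) \<le> ?q (size d)" for d
      using f(2)[of d] g(2)[of d] by simp
    fix b
    have "oracle_free (?c b)"
      using p(3)[of "Suc b"] f(3)[of b] g(3)[of b] by (simp add: implements_def)
    moreover have "runs (?c b) s (?q (size (s b)))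
      (\<lambda>s'. s' b = (if p (s b) = Leaf then f (s b) else g (s b)) \<and> (\<forall>x<b. s' x = s x))" for s
    proof (intro runs_Seq runs_Assign implementsD[OF p(3) _ p(1)])
      fix s' :: state
      assume s': "s' (Suc b) = p ((s(Suc b := eval_exp (Var b) s)) (Suc b))"
        "\<And>x. x < Suc b \<Longrightarrow> s' x = (s(Suc b := eval_exp (Var b) s)) x"
      let ?Q = "\<lambda>s'. s' b = (if p (s b) = Leaf then f (s b) else g (s b)) \<and> (\<forall>x<b. s' x = s x)"
      \<comment> \<open>The sum stands in for the maximum over the two branches, since
        \<open>growth\<close> is closed under addition.\<close>
      have "runs (if s' (Suc b) = Leaf then F b else G b) s' (qf (size (s b)) + qg (size (s b))) ?Q"
      proof (cases "p (s b) = Leaf")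
        case True
        have "runs (F b) s' (qf (size (s b))) ?Q"
          by (rule implementsD[OF f(3) _ f(1)]) (use s' True in auto)
        then show ?thesis
          using s' True by (auto elim: runs_mono)
      next
        case False
        have "runs (G b) s' (qg (size (s b))) ?Q"
          by (rule implementsD[OF g(3) _ g(1)]) (use s' False in auto)
        then show ?thesis
          using s' False by (auto elim: runs_mono)
      qed
      then have "runs (Cond (Var (Suc b)) (G b) (F b)) s'
          (Suc (cost (Var (Suc b)) s' + (qf (size (s b)) + qg (size (s b))))) ?Q"
        by (intro runs_Cond) simp
      then show "runs (Cond (Var (Suc b)) (G b) (F b)) s'
          (2 + qp (size (s b)) + (qf (size (s b)) + qg (size (s b)))) ?Q"
        by (rule runs_mono) (use s' p(2)[of "s b"] in auto)
    qed auto
    ultimately show "\<exists>c. implements c b (\<lambda>d. if p d = Leaf then f d else g d) ?q"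
      unfolding implements_def by blast
  qed
qed

section \<open>Lists as trees and bounded iteration\<close>

fun dec_list :: "data \<Rightarrow> data list" where
  "dec_list Leaf = []"
| "dec_list (Node x xs) = x # dec_list xs"

lemma dec_enc_list [simp]: "dec_list (enc_list xs) = xs"
  by (induction xs) auto

lemma enc_dec_list [simp]: "enc_list (dec_list d) = d"
  by (induction d) auto

lemma enc_list_eq_Leaf [simp]: "enc_list xs = Leaf \<longleftrightarrow> xs = []"
  by (cases xs) auto

lemma size_enc_list: "size (enc_list xs) = (\<Sum>x\<leftarrow>xs. Suc (size x))"
  by (induction xs) auto

lemma size_enc_list_ge: "length xs \<le> size (enc_list xs)"
  by (induction xs) auto

lemma size_member_enc_list: "x \<in> set xs \<Longrightarrow> size x < size (enc_list xs)"
  by (induction xs) auto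

lemma size_enc_list_le:
  "(\<And>x. x \<in> set xs \<Longrightarrow> size x \<le> m) \<Longrightarrow> size (enc_list xs) \<le> length xs * Suc m"
proof (induction xs)
  case (Cons x xs)
  from Cons.prems[of x] Cons.IH Cons.prems show ?case by force
qed simp

text \<open>Cobham's bounded recursion: iterating a polynomial-time step stays polynomial as long as
  the intermediate values of the accumulator do.\<close>

lemma ptime_fold:
  assumes F: "ptime (\<lambda>z. F (hd_data z) (hd_data (tl_data z)) (tl_data (tl_data z)))"
    and l: "ptime (\<lambda>d. enc_list (l d))" and a: "ptime a"
    and q: "growth q" and sz: "\<And>d n. size (fold (F d) (take n (l d)) (a d)) \<le> q (size d)"
  shows "ptime (\<lambda>d. fold (F d) (l d) (a d))"
proof -
  obtain qF C where F: "growth qF" "\<And>z. size (F (hd_data z) (hd_data (tl_data z)) (tl_data (tl_data z))) \<le> qF (size z)"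
    and C: "\<And>b. implements (C b) b (\<lambda>z. F (hd_data z) (hd_data (tl_data z)) (tl_data (tl_data z))) qF"
    by (rule ptimeE[OF F]) (rule that)
  obtain ql L where ql: "growth ql" and l: "\<And>d. size (enc_list (l d)) \<le> ql (size d)"
    and L: "\<And>b. implements (L b) b (\<lambda>d. enc_list (l d)) ql"
    by (rule ptimeE[OF l]) (rule that)
  obtain qa A where qa: "growth qa" "\<And>d. size (a d) \<le> qa (size d)" and A: "\<And>b. implements (A b) b a qa"
    by (rule ptimeE[OF a]) (rule that)
  \<comment> \<open>Bounds the argument \<open>Node d (Node x y)\<close> of a step, with accumulator
    \<open>y\<close> of size at most \<open>q\<close>; the 2 counts the two new nodes.\<close>
  define m where "m n = n + ql n + q n + 2" for n
  have m: "growth m"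
    unfolding m_def by (intro growth_intros ql q)
  define U where "U n = 8 * m n + (qF (m n) + (2 * m n + 8 * m n))" for n
  have U: "growth U"
    unfolding U_def by (intro growth_intros growth_compose[OF F(1)] m)
  \<comment> \<open>Variables: \<open>b\<close> holds the input, \<open>b+1\<close> the rest of the
    list, \<open>b+2\<close> the accumulator, \<open>b+3\<close> the argument of the step and then
    its result.\<close>
  define W where "W b = While (Var (Suc b))
     (Seq (Assign (b+3) (Cons_exp (Var b) (Cons_exp (Hd (Var (Suc b))) (Var (b+2)))))
     (Seq (C (b+3)) (Seq (Assign (b+2) (Var (b+3))) (Assign (Suc b) (Tl (Var (Suc b)))))))" for b
  \<comment> \<open>Invariant: \<open>ys\<close> is consumed and \<open>xs\<close> is left. The
    extra round in \<open>Suc (length xs)\<close> pays for the final failing test.\<close>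
  have W: "runs (W b) s (Suc (length xs) * (2 * m (size d) + U (size d)))
     (\<lambda>s'. s' (b+2) = fold (F d) (l d) (a d) \<and> (\<forall>x\<le>b. s' x = s x))"
    if "s b = d" "s (Suc b) = enc_list xs" "s (b+2) = fold (F d) ys (a d)" "l d = ys @ xs"
    for b s d xs ys
    using that
  proof (induction xs arbitrary: s ys)
    case Nil
    then have "runs (W b) s (Suc (cost (Var (Suc b)) s))
        (\<lambda>s'. s' (b+2) = fold (F d) (l d) (a d) \<and> (\<forall>x\<le>b. s' x = s x))"
      unfolding W_def by (intro runs_WhileF) auto
    then show ?case
      by (rule runs_mono) (use Nil in \<open>auto simp: m_def\<close>)
  next
    case (Cons x xs)
    let ?y = "fold (F d) ys (a d)" and ?y' = "fold (F d) (ys @ [x]) (a d)"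
    have ld: "l d = (ys @ [x]) @ xs"
      using Cons.prems by simp
    have y: "size ?y \<le> q (size d)" "size ?y' \<le> q (size d)"
      using sz[of d "length ys"] sz[of d "length (ys @ [x])"] Cons.prems(4) by auto
    have lx: "size (enc_list (x # xs)) \<le> ql (size d)"
      using l[of d] Cons.prems(4) by (simp add: size_enc_list)
    have x: "size d + Suc (size x) + size ?y < m (size d)"
      using y lx by (simp add: m_def)
    have step: "runs (Seq (Assign (b+3) (Cons_exp (Var b) (Cons_exp (Hd (Var (Suc b))) (Var (b+2)))))
       (Seq (C (b+3)) (Seq (Assign (b+2) (Var (b+3))) (Assign (Suc b) (Tl (Var (Suc b)))))))
       s (U (size d)) (\<lambda>s'. s' (Suc b) = enc_list xs \<and> s' (b+2) = ?y' \<and> (\<forall>x\<le>b. s' x = s x))"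
      unfolding U_def
    proof (intro runs_Seq runs_Assign implementsD[OF C _ F(1)], goal_cases)
      case 1
      then show ?case using Cons.prems x lx y by (simp add: m_def)
    next
      case 2
      then show ?case using Cons.prems x by simp
    next
      case (3 s')
      then show ?case using Cons.prems x y by (simp add: m_def)
    next
      case (4 s')
      then show ?case using Cons.prems x y lx by (simp add: m_def)
    next
      case (5 s')
      then show ?case using Cons.prems by (auto simp: less_Suc_eq_le)
    qed
    have "runs (W b) s (Suc (cost (Var (Suc b)) s + U (size d) +
          Suc (length xs) * (2 * m (size d) + U (size d))))
        (\<lambda>s'. s' (b+2) = fold (F d) (l d) (a d) \<and> (\<forall>x\<le>b. s' x = s x))"
      unfolding W_def
    proof (rule runs_WhileT, goal_cases)
      case 1
      then show ?case using Cons.prems by simp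
    next
      case 2
      show ?case
        by (rule runs_mono[OF step order_refl], fold W_def,
            rule runs_mono[OF Cons.IH[OF _ _ _ ld] order_refl]) (use Cons.prems in auto)
    qed
    then show ?case
      by (rule runs_mono) (use lx Cons.prems in \<open>auto simp: m_def\<close>)
  qed
  let ?c = "\<lambda>b. Seq (Assign (Suc b) (Var b)) (Seq (L (Suc b)) (Seq (Assign (b+2) (Var b))
     (Seq (A (b+2)) (Seq (W b) (Assign b (Var (b+2)))))))"
  let ?q = "\<lambda>n. (2 + n) + (ql n + ((2 + n) + (qa n + (Suc (ql n) * (2 * m n + U n) + (2 + q n)))))"
  show ?thesis
    unfolding ptime_def
  proof (intro exI[of _ ?q] conjI allI)
    show "growth ?q"
      by (intro growth_intros ql qa(1) m U q)
    show "size (fold (F d) (l d) (a d)) \<le> ?q (size d)" for d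
      using sz[of d "length (l d)"] by simp
    fix b
    have "oracle_free (?c b)"
      using L[of "Suc b"] A[of "b+2"] C[of "b+3"] by (simp add: implements_def W_def)
    moreover have "runs (?c b) s (?q (size (s b))) (\<lambda>s'. s' b = fold (F (s b)) (l (s b)) (a (s b)) \<and> (\<forall>x<b. s' x = s x))" for s
    proof -
      let ?d = "s b"
      have len: "length (l ?d) \<le> ql (size ?d)"
        using l[of ?d] size_enc_list_ge[of "l ?d"] by linarith
      have res: "size (fold (F ?d) (l ?d) (a ?d)) \<le> q (size ?d)"
        using sz[of ?d "length (l ?d)"] by simp
      show ?thesis
      proof (intro runs_Seq runs_Assign implementsD[OF L _ ql] implementsD[OF A _ qa(1)], goal_cases)
        case (5 s1 s2)
        then have s2: "s2 b = ?d" "s2 (Suc b) = enc_list (l ?d)" "s2 (b+2) = fold (F ?d) [] (a ?d)"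
          "l ?d = [] @ l ?d" "\<And>x. x \<le> b \<Longrightarrow> s2 x = s x"
          by auto
        from W[OF s2(1-4)] show ?case
          by (rule runs_mono) (use len res s2(5) in \<open>auto intro!: runs_Assign mult_right_mono\<close>)
      qed auto
    qed
    ultimately show "\<exists>c. implements c b (\<lambda>d. fold (F d) (l d) (a d)) ?q"
      unfolding implements_def by blast
  qed
qed

text \<open>Functions with a parameter are treated uncurried, on pairs; this rule supplies the
  pair.\<close>

lemma ptime_compose2:
  assumes "ptime (\<lambda>z. f (hd_data z) (tl_data z))" "ptime g" "ptime h"
  shows "ptime (\<lambda>d. f (g d) (h d))"
  using ptime_compose[OF assms(1) ptime_Node[OF assms(2,3)]] by simp

lemma ptime_size_bound:
  assumes "ptime f"
  obtains q where "growth q" "\<And>d. size (f d) \<le> q (size d)"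
  by (rule ptimeE[OF assms]) (rule that)

text \<open>List elements are smaller than the list, so one bound in the size of the input serves
  all of them.\<close>

lemma ptime_size_bound2:
  assumes f: "ptime (\<lambda>z. f (hd_data z) (tl_data z))" and l: "ptime (\<lambda>d. enc_list (l d))"
  obtains q where "growth q" "\<And>d x. x \<in> set (l d) \<Longrightarrow> size (f d x) \<le> q (size d)"
proof -
  obtain qf where qf: "growth qf" "\<And>z. size (f (hd_data z) (tl_data z)) \<le> qf (size z)"
    by (rule ptime_size_bound[OF f]) (rule that)
  obtain ql where ql: "growth ql" "\<And>d. size (enc_list (l d)) \<le> ql (size d)"
    by (rule ptime_size_bound[OF l]) (rule that)
  show thesis
  proof (rule that)
    show "growth (\<lambda>n. qf (n + ql n))"
      by (intro growth_compose[OF qf(1)] growth_intros ql)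
    show "size (f d x) \<le> qf (size d + ql (size d))" if "x \<in> set (l d)" for d x
    proof -
      have "size (f d x) \<le> qf (size (Node d x))"
        using qf(2)[of "Node d x"] by simp
      also have "\<dots> \<le> qf (size d + ql (size d))"
        using size_member_enc_list[OF that] ql(2)[of d] by (intro growth_mono[OF qf(1)]) simp
      finally show ?thesis .
    qed
  qed
qed

text \<open>Discharges the size condition of \<open>ptime_fold\<close>: a growth per step that is
  independent of the accumulator sums up to a polynomial, whereas repeated doubling would be
  exponential.\<close>

lemma ptime_fold_additive:
  assumes F: "ptime (\<lambda>z. F (hd_data z) (hd_data (tl_data z)) (tl_data (tl_data z)))"
    and l: "ptime (\<lambda>d. enc_list (l d))" and a: "ptime a"
    and q: "growth q" and sz: "\<And>d x y. x \<in> set (l d) \<Longrightarrow> size (F d x y) \<le> size y + q (size d)"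
  shows "ptime (\<lambda>d. fold (F d) (l d) (a d))"
proof -
  obtain qa where qa: "growth qa" "\<And>d. size (a d) \<le> qa (size d)"
    by (rule ptime_size_bound[OF a]) (rule that)
  obtain ql where ql: "growth ql" "\<And>d. size (enc_list (l d)) \<le> ql (size d)"
    by (rule ptime_size_bound[OF l]) (rule that)
  have bound: "size (fold (F d) xs y) \<le> size y + length xs * q (size d)"
    if "set xs \<subseteq> set (l d)" for d xs y
    using that
  proof (induction xs arbitrary: y)
    case (Cons x xs)
    have "size (fold (F d) (x # xs) y) \<le> size (F d x y) + length xs * q (size d)"
      using Cons.IH[of "F d x y"] Cons.prems by simp
    also have "\<dots> \<le> size y + q (size d) + length xs * q (size d)"
      using sz[of x d y] Cons.prems by simp
    finally show ?case by simp
  qed simp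
  show ?thesis
  proof (rule ptime_fold[OF F l a])
    show "growth (\<lambda>n. qa n + ql n * q n)"
      by (intro growth_intros qa ql q)
    fix d n
    have "length (take n (l d)) \<le> ql (size d)"
      using size_enc_list_ge[of "l d"] ql(2)[of d] by simp
    then have "length (take n (l d)) * q (size d) \<le> ql (size d) * q (size d)"
      by (rule mult_right_mono) simp
    then show "size (fold (F d) (take n (l d)) (a d)) \<le> qa (size d) + ql (size d) * q (size d)"
      using bound[of "take n (l d)" d "a d"] qa(2)[of d] set_take_subset[of n "l d"] by linarith
  qed
qed

lemma enc_bool_eq_Leaf [simp]: "enc_bool b = Leaf \<longleftrightarrow> \<not> b"
  by (simp add: enc_bool_def)

lemma ptime_if:
  assumes "ptime (\<lambda>d. enc_bool (P d))" "ptime f" "ptime g"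
  shows "ptime (\<lambda>d. if P d then f d else g d)"
proof -
  have "(\<lambda>d. if P d then f d else g d) = (\<lambda>d. if enc_bool (P d) = Leaf then g d else f d)"
    by auto
  then show ?thesis
    using ptime_if_Leaf[OF assms(1,3,2)] by (simp only:)
qed

lemma ptime_not:
  assumes "ptime (\<lambda>d. enc_bool (P d))"
  shows "ptime (\<lambda>d. enc_bool (\<not> P d))"
proof -
  have "(\<lambda>d. enc_bool (\<not> P d)) = (\<lambda>d. if P d then enc_bool False else enc_bool True)"
    by (auto simp del: if_True)
  then show ?thesis
    using ptime_if[OF assms ptime_const ptime_const] by (simp only:)
qed

lemma ptime_conj:
  assumes "ptime (\<lambda>d. enc_bool (P d))" "ptime (\<lambda>d. enc_bool (Q d))"
  shows "ptime (\<lambda>d. enc_bool (P d \<and> Q d))"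
proof -
  have "(\<lambda>d. enc_bool (P d \<and> Q d)) = (\<lambda>d. if P d then enc_bool (Q d) else enc_bool False)"
    by auto
  then show ?thesis
    using ptime_if[OF assms ptime_const] by (simp only:)
qed

lemma ptime_disj:
  assumes "ptime (\<lambda>d. enc_bool (P d))" "ptime (\<lambda>d. enc_bool (Q d))"
  shows "ptime (\<lambda>d. enc_bool (P d \<or> Q d))"
proof -
  have "(\<lambda>d. enc_bool (P d \<or> Q d)) = (\<lambda>d. if P d then enc_bool True else enc_bool (Q d))"
    by auto
  then show ?thesis
    using ptime_if[OF assms(1) ptime_const assms(2)] by (simp only:)
qed

lemma ptime_imp:
  assumes "ptime (\<lambda>d. enc_bool (P d))" "ptime (\<lambda>d. enc_bool (Q d))"
  shows "ptime (\<lambda>d. enc_bool (P d \<longrightarrow> Q d))"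
proof -
  have "(\<lambda>d. enc_bool (P d \<longrightarrow> Q d)) = (\<lambda>d. if P d then enc_bool (Q d) else enc_bool True)"
    by auto
  then show ?thesis
    using ptime_if[OF assms ptime_const] by (simp only:)
qed

text \<open>As an introduction rule it ends a chain of list combinators at a tree-valued
  function.\<close>

lemma ptime_dec_list: "ptime f \<Longrightarrow> ptime (\<lambda>d. enc_list (dec_list (f d)))"
  by simp

lemmas ptime_basic_intros = ptime_const ptime_id ptime_Node ptime_hd ptime_tl ptime_eq
  ptime_if ptime_not ptime_conj ptime_disj ptime_imp ptime_dec_list

lemma ptime_Nil: "ptime (\<lambda>d. enc_list [])"
  by (simp add: ptime_const)

lemma ptime_Cons:
  "ptime f \<Longrightarrow> ptime (\<lambda>d. enc_list (l d)) \<Longrightarrow> ptime (\<lambda>d. enc_list (f d # l d))"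
  by (simp add: ptime_Node)

lemma fold_Node: "fold Node xs (enc_list ys) = enc_list (rev xs @ ys)"
  by (induction xs arbitrary: ys) (auto simp flip: enc_list.simps)

lemma ptime_revappend:
  assumes l: "ptime (\<lambda>d. enc_list (l d))" and m: "ptime (\<lambda>d. enc_list (m d))"
  shows "ptime (\<lambda>d. enc_list (rev (l d) @ m d))"
proof -
  obtain q where q: "growth q" "\<And>d x. x \<in> set (l d) \<Longrightarrow> size x \<le> q (size d)"
    by (rule ptime_size_bound2[OF _ l, of "\<lambda>_ x. x"]) (intro ptime_basic_intros, rule that)
  have "ptime (\<lambda>d. fold (\<lambda>x y. Node x y) (l d) (enc_list (m d)))"
    by (rule ptime_fold_additive[where q = "\<lambda>n. Suc (q n)"])
      (intro ptime_basic_intros l m growth_intros q | simp add: q)+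
  then show ?thesis
    by (simp add: fold_Node)
qed

lemma ptime_rev:
  "ptime (\<lambda>d. enc_list (l d)) \<Longrightarrow> ptime (\<lambda>d. enc_list (rev (l d)))"
  using ptime_revappend[OF _ ptime_Nil] by simp

lemma ptime_append:
  "ptime (\<lambda>d. enc_list (l d)) \<Longrightarrow> ptime (\<lambda>d. enc_list (m d)) \<Longrightarrow> ptime (\<lambda>d. enc_list (l d @ m d))"
  using ptime_revappend[OF ptime_rev] by simp

text \<open>Prepending the blocks while folding over the reversed list restores their order. The
  accumulator is a tree read as a list, and it grows by exactly the size of the block.\<close>

lemma ptime_concat_map:
  assumes f: "ptime (\<lambda>z. enc_list (f (hd_data z) (tl_data z)))" and l: "ptime (\<lambda>d. enc_list (l d))"
  shows "ptime (\<lambda>d. enc_list (concat (map (f d) (l d))))"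
proof -
  obtain q where q: "growth q" "\<And>d x. x \<in> set (l d) \<Longrightarrow> size (enc_list (f d x)) \<le> q (size d)"
    by (rule ptime_size_bound2[OF f l]) (rule that)
  have "ptime (\<lambda>d. fold (\<lambda>x y. enc_list (f d x @ dec_list y)) (rev (l d)) Leaf)"
  proof (rule ptime_fold_additive[OF _ ptime_rev[OF l] ptime_const q(1)])
    show "ptime (\<lambda>z. enc_list (f (hd_data z) (hd_data (tl_data z)) @ dec_list (tl_data (tl_data z))))"
      by (intro ptime_append ptime_basic_intros ptime_compose2[where f = "\<lambda>x y. enc_list (f x y)", OF f])
    fix d x y
    assume "x \<in> set (rev (l d))"
    then have "size (enc_list (f d x)) \<le> q (size d)"
      by (simp add: q)
    moreover have "size y = size (enc_list (dec_list y))"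
      by simp
    ultimately show "size (enc_list (f d x @ dec_list y)) \<le> size y + q (size d)"
      unfolding size_enc_list by simp
  qed
  moreover have "fold (\<lambda>x y. enc_list (f d x @ dec_list y)) (rev xs) Leaf = enc_list (concat (map (f d) xs))"
    for d xs
    by (induction xs) auto
  ultimately show ?thesis
    by simp
qed

lemma ptime_map:
  assumes f: "ptime (\<lambda>z. f (hd_data z) (tl_data z))" and l: "ptime (\<lambda>d. enc_list (l d))"
  shows "ptime (\<lambda>d. enc_list (map (f d) (l d)))"
proof -
  have "ptime (\<lambda>d. enc_list (concat (map (\<lambda>x. [f d x]) (l d))))"
    by (intro ptime_concat_map ptime_Cons ptime_Nil f l)
  moreover have "concat (map (\<lambda>x. [f d x]) xs) = map (f d) xs" for d xs
    by (induction xs) auto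
  ultimately show ?thesis
    by simp
qed

lemma ptime_filter:
  assumes P: "ptime (\<lambda>z. enc_bool (P (hd_data z) (tl_data z)))" and l: "ptime (\<lambda>d. enc_list (l d))"
  shows "ptime (\<lambda>d. enc_list (filter (P d) (l d)))"
proof -
  \<comment> \<open>The list \<open>[x]\<close> or \<open>[]\<close> is written as a decoded tree,
    so that the case distinction takes place on trees.\<close>
  have "ptime (\<lambda>d. enc_list (concat (map (\<lambda>x. dec_list (if P d x then Node x Leaf else Leaf)) (l d))))"
    by (intro ptime_concat_map ptime_basic_intros P l)
  moreover have "concat (map (\<lambda>x. dec_list (if P d x then Node x Leaf else Leaf)) xs) = filter (P d) xs"
    for d xs
    by (induction xs) auto
  ultimately show ?thesis
    by simp
qed

lemma ptime_Bex:
  assumes P: "ptime (\<lambda>z. enc_bool (P (hd_data z) (tl_data z)))" and l: "ptime (\<lambda>d. enc_list (l d))"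
  shows "ptime (\<lambda>d. enc_bool (\<exists>x\<in>set (l d). P d x))"
proof -
  have "ptime (\<lambda>d. enc_bool (enc_list (filter (P d) (l d)) \<noteq> Leaf))"
    by (intro ptime_basic_intros ptime_filter P l)
  moreover have "(enc_list (filter (P d) xs) \<noteq> Leaf) \<longleftrightarrow> (\<exists>x\<in>set xs. P d x)" for d xs
    by (simp add: filter_empty_conv)
  ultimately show ?thesis
    by (simp only:)
qed

lemma ptime_Ball:
  assumes P: "ptime (\<lambda>z. enc_bool (P (hd_data z) (tl_data z)))" and l: "ptime (\<lambda>d. enc_list (l d))"
  shows "ptime (\<lambda>d. enc_bool (\<forall>x\<in>set (l d). P d x))"
  using ptime_not[OF ptime_Bex[OF ptime_not[OF P] l]] by simp

section \<open>Positions in unary\<close>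

definition unary :: "nat \<Rightarrow> data" where
  "unary i = enc_list (replicate i Leaf)"

lemma size_unary [simp]: "size (unary i) = i"
  by (simp add: unary_def size_enc_list sum_list_replicate)

lemma unary_inject [simp]: "unary i = unary j \<longleftrightarrow> i = j"
  by (metis size_unary)

lemma unary_Suc: "unary (Suc i) = Node Leaf (unary i)"
  by (simp add: unary_def)

definition indices :: "data list \<Rightarrow> data list" where
  "indices xs = map unary [0..<length xs]"

text \<open>The head of the accumulator doubles as the counter: each step pushes its successor on
  top.\<close>

lemma fold_indices:
  "fold (\<lambda>_ y. Node (Node Leaf (hd_data y)) y) xs (enc_list [Leaf]) =
     enc_list (unary (length xs) # rev (indices xs))"
proof (induction xs rule: rev_induct)
  case Nil
  then show ?case by (simp add: unary_def indices_def)
next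
  case (snoc x xs)
  then show ?case by (simp add: unary_Suc indices_def)
qed

lemma ptime_indices:
  assumes l: "ptime (\<lambda>d. enc_list (l d))"
  shows "ptime (\<lambda>d. enc_list (indices (l d)))"
proof -
  obtain q where q: "growth q" "\<And>d. size (enc_list (l d)) \<le> q (size d)"
    by (rule ptime_size_bound[OF l]) (rule that)
  \<comment> \<open>\<open>ptime_fold_additive\<close> does not apply, because a step duplicates the
    head of an arbitrary accumulator. The bound uses the actual values: at most \<open>q + 1\<close>
    numbers of size at most \<open>q\<close> each.\<close>
  have "ptime (\<lambda>d. fold (\<lambda>_ y. Node (Node Leaf (hd_data y)) y) (l d) (enc_list [Leaf]))"
  proof (rule ptime_fold[OF _ l ptime_const, where q = "\<lambda>n. Suc (q n) * Suc (q n)"])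
    fix d n
    have len: "length (take n (l d)) \<le> q (size d)"
      using size_enc_list_ge[of "l d"] q(2)[of d] by simp
    have "size (enc_list (unary (length (take n (l d))) # rev (indices (take n (l d)))))
       \<le> length (unary (length (take n (l d))) # rev (indices (take n (l d)))) * Suc (q (size d))"
      by (rule size_enc_list_le) (use len in \<open>auto simp: indices_def\<close>)
    also have "\<dots> \<le> Suc (q (size d)) * Suc (q (size d))"
      by (rule mult_right_mono) (use len in \<open>auto simp: indices_def\<close>)
    finally show "size (fold (\<lambda>_ y. Node (Node Leaf (hd_data y)) y) (take n (l d)) (enc_list [Leaf]))
        \<le> Suc (q (size d)) * Suc (q (size d))"
      by (simp only: fold_indices)
  qed (intro ptime_basic_intros growth_intros q)+
  then have "ptime (\<lambda>d. enc_list (unary (length (l d)) # rev (indices (l d))))"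
    by (simp only: fold_indices)
  then have "ptime (\<lambda>d. enc_list (rev (dec_list (tl_data (enc_list (unary (length (l d)) # rev (indices (l d))))))))"
    by (intro ptime_rev ptime_basic_intros)
  then show ?thesis
    by simp
qed

text \<open>The unary index drives the fold, one tail per digit. Head and tail of
  \<open>Leaf\<close> are \<open>Leaf\<close>, so an index out of range reads as the bit 0.\<close>

definition nth_data :: "data \<Rightarrow> data \<Rightarrow> data" where
  "nth_data i x = hd_data (fold (\<lambda>_ y. tl_data y) (dec_list i) x)"

lemma nth_data_enc_list:
  "nth_data (unary i) (enc_list xs) = (if i < length xs then xs ! i else Leaf)"
proof -
  have "fold (\<lambda>_ y. tl_data y) (replicate i Leaf) (enc_list xs) = enc_list (drop i xs)"
  proof (induction i arbitrary: xs)
    case (Suc i)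
    then show ?case
      by (cases xs) (use Suc[of "[]"] in auto)
  qed simp
  then show ?thesis
    by (auto simp: nth_data_def unary_def Cons_nth_drop_Suc[symmetric])
qed

lemma ptime_nth_data:
  assumes "ptime f" "ptime g"
  shows "ptime (\<lambda>d. nth_data (f d) (g d))"
  unfolding nth_data_def
  by (intro ptime_hd ptime_fold_additive[where q = "\<lambda>_. 0"] ptime_basic_intros assms growth_intros)
    simp

lemmas ptime_intros = ptime_basic_intros ptime_Cons ptime_append ptime_rev ptime_concat_map ptime_map
  ptime_filter ptime_Bex ptime_Ball ptime_indices ptime_nth_data

section \<open>Binary successor and counting\<close>

fun inc :: "data \<Rightarrow> data" where
  "inc Leaf = Node (enc_bool True) Leaf"
| "inc (Node b x) = (if b = Leaf then Node (enc_bool True) x else Node Leaf (inc x))"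

lemma inc_enc_nat: "inc (enc_nat n) = enc_nat (Suc n)"
proof (induction n rule: less_induct)
  case (less n)
  show ?case
  proof (cases "n = 0")
    case True
    then show ?thesis
      by (simp add: enc_nat.simps[of 0] enc_nat.simps[of "Suc 0"])
  next
    case False
    then show ?thesis
      using less.IH[of "n div 2"]
      by (cases "even n") (simp_all add: enc_nat.simps[of n] enc_nat.simps[of "Suc n"] enc_bool_def)
  qed
qed

lemma size_inc: "size (inc d) \<le> size d + 2"
  by (induction d) (auto simp: enc_bool_def)

text \<open>The accumulator is a pair of the current carry and the reversed output.\<close>

definition inc_step :: "data \<Rightarrow> data \<Rightarrow> data" where
  "inc_step b y =
     (if hd_data y = Leaf then Node Leaf (Node b (tl_data y))
      else if b = Leaf then Node Leaf (Node (enc_bool True) (tl_data y))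
      else Node (enc_bool True) (Node Leaf (tl_data y)))"

lemma inc_step_simps [simp]:
  "inc_step b (Node Leaf y) = Node Leaf (Node b y)"
  "inc_step Leaf (Node (enc_bool True) y) = Node Leaf (Node (enc_bool True) y)"
  "b \<noteq> Leaf \<Longrightarrow> inc_step b (Node (enc_bool True) y) = Node (enc_bool True) (Node Leaf y)"
  by (simp_all add: inc_step_def)

lemma fold_inc_step_no_carry:
  "fold inc_step xs (Node Leaf (enc_list ys)) = Node Leaf (enc_list (rev xs @ ys))"
proof (induction xs arbitrary: ys)
  case (Cons x xs)
  then show ?case using Cons.IH[of "x # ys"] by simp
qed simp

text \<open>While the carry survives, digits turn to 0; once it is gone, the rest is copied. A carry
  left at the end becomes a new leading digit.\<close>

lemma fold_inc_step:
  assumes "z = fold inc_step xs (Node (enc_bool True) (enc_list ys))"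
  shows "enc_list (rev (dec_list (if hd_data z = Leaf then tl_data z
      else Node (enc_bool True) (tl_data z)))) = enc_list (rev ys @ dec_list (inc (enc_list xs)))"
  using assms
proof (induction xs arbitrary: ys)
  case (Cons b xs)
  show ?case
  proof (cases "b = Leaf")
    case True
    then have "z = fold inc_step xs (Node Leaf (enc_list (enc_bool True # ys)))"
      using Cons.prems by simp
    then show ?thesis
      using True by (simp only: fold_inc_step_no_carry) simp
  next
    case False
    then show ?thesis
      using Cons.IH[of "Leaf # ys"] Cons.prems by simp
  qed
qed simp

lemma ptime_inc:
  assumes "ptime f"
  shows "ptime (\<lambda>d. inc (f d))"
proof -
  let ?z = "\<lambda>d. fold (\<lambda>b y. inc_step b y) (dec_list d) (Node (enc_bool True) (enc_list []))"
  have z: "ptime ?z"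
  proof (rule ptime_fold_additive[where q = "\<lambda>n. n + 3"])
    fix d x y :: data
    assume "x \<in> set (dec_list d)"
    then have "size x < size d"
      using size_member_enc_list[of x "dec_list d"] by simp
    then show "size (inc_step x y) \<le> size y + (size d + 3)"
      by (cases y) (auto simp: inc_step_def enc_bool_def)
  qed (unfold inc_step_def, (intro ptime_intros growth_intros)+)
  have "ptime (\<lambda>d. enc_list (rev (dec_list (if hd_data (?z d) = Leaf then tl_data (?z d)
      else Node (enc_bool True) (tl_data (?z d))))))"
    by (intro ptime_intros z)
  then have "ptime inc"
    by (simp add: fold_inc_step[OF refl, of _ "[]", simplified])
  from ptime_compose[OF this assms] show ?thesis .
qed

definition count_true :: "data \<Rightarrow> data" where
  "count_true d = fold (\<lambda>x y. if x = Leaf then y else inc y) (dec_list d) Leaf"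

lemma count_true_enc_list:
  "count_true (enc_list xs) = enc_nat (length (filter (\<lambda>x. x \<noteq> Leaf) xs))"
proof -
  have "fold (\<lambda>x y. if x = Leaf then y else inc y) xs (enc_nat n) =
      enc_nat (n + length (filter (\<lambda>x. x \<noteq> Leaf) xs))" for n
    by (induction xs arbitrary: n) (auto simp: inc_enc_nat)
  from this[of 0] show ?thesis
    by (simp add: count_true_def enc_nat.simps[of 0])
qed

lemma size_enc_nat: "size (enc_nat n) \<le> 2 * n"
proof (induction n rule: less_induct)
  case (less n)
  show ?case
  proof (cases "n = 0")
    case False
    have "size (enc_nat n) \<le> 2 + size (enc_nat (n div 2))"
      using False size_enc_bool[of "odd n"] by (simp add: enc_nat.simps[of n])
    moreover have "size (enc_nat (n div 2)) \<le> 2 * (n div 2)"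
      using less.IH[of "n div 2"] False by simp
    moreover have "n = 1 \<longrightarrow> n div 2 = 0"
      by simp
    ultimately show ?thesis
      using False by (cases "n = 1") (auto simp: enc_nat.simps[of 0] enc_nat.simps[of 1] enc_bool_def)
  qed (simp add: enc_nat.simps[of 0])
qed

text \<open>Needed for every tree, since the simulated program may query anything. A true entry
  contributes at least 2 to the size of the list, and the binary notation of a number is at most
  twice the number.\<close>

lemma size_count_true: "size (count_true d) \<le> size d"
proof -
  have "2 * length (filter (\<lambda>x. x \<noteq> Leaf) xs) \<le> size (enc_list xs)" for xs
  proof (induction xs)
    case (Cons x xs)
    then show ?case by (cases x) auto
  qed simp
  from this[of "dec_list d"] show ?thesis
    using count_true_enc_list[of "dec_list d"]
      size_enc_nat[of "length (filter (\<lambda>x. x \<noteq> Leaf) (dec_list d))"] by simp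
qed

lemma ptime_count_true: "ptime count_true"
proof -
  have "ptime (\<lambda>d. fold (\<lambda>x y. if x = Leaf then y else inc y) (dec_list d) Leaf)"
    by (rule ptime_fold_additive[where q = "\<lambda>_. 2"])
      (intro ptime_intros ptime_inc growth_intros | auto intro: order_trans[OF size_inc])+
  then show ?thesis
    by (simp add: count_true_def[abs_def])
qed

section \<open>Replacing oracle queries by a subroutine\<close>

fun vars_exp :: "exp \<Rightarrow> nat set" where
  "vars_exp Nil_exp = {}"
| "vars_exp (Var x) = {x}"
| "vars_exp (Cons_exp a b) = vars_exp a \<union> vars_exp b"
| "vars_exp (Hd a) = vars_exp a"
| "vars_exp (Tl a) = vars_exp a"
| "vars_exp (Eq a b) = vars_exp a \<union> vars_exp b"

fun vars_com :: "com \<Rightarrow> nat set" where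
  "vars_com Skip = {}"
| "vars_com (Assign x e) = insert x (vars_exp e)"
| "vars_com (Query x y) = {x, y}"
| "vars_com (Seq c d) = vars_com c \<union> vars_com d"
| "vars_com (Cond e c d) = vars_exp e \<union> vars_com c \<union> vars_com d"
| "vars_com (While e c) = vars_exp e \<union> vars_com c"

lemma finite_vars_com: "finite (vars_com c)"
proof -
  have "finite (vars_exp e)" for e
    by (induction e) auto
  then show ?thesis
    by (induction c) auto
qed

lemma eval_exp_cong: "(\<And>x. x \<in> vars_exp e \<Longrightarrow> s x = u x) \<Longrightarrow> eval_exp e s = eval_exp e u"
  by (induction e) auto

lemma cost_cong: "(\<And>x. x \<in> vars_exp e \<Longrightarrow> s x = u x) \<Longrightarrow> cost e s = cost e u"
proof (induction e)
  case (Cons_exp e1 e2)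
  then show ?case using eval_exp_cong[of e1 s u] eval_exp_cong[of e2 s u] by simp
next
  case (Eq e1 e2)
  then show ?case using eval_exp_cong[of e1 s u] eval_exp_cong[of e2 s u] by simp
next
  case (Hd e)
  then show ?case using eval_exp_cong[of e s u] by simp
next
  case (Tl e)
  then show ?case using eval_exp_cong[of e s u] by simp
qed auto

lemma size_eval_exp: "size (eval_exp e s) \<le> cost e s"
  by (cases e) simp_all

text \<open>The subroutine works from \<open>Suc b\<close> on. With the program's own variables
  below \<open>b\<close>, the variable \<open>b\<close> stays free for a value that must survive the
  simulation.\<close>

fun replace_queries :: "nat \<Rightarrow> com \<Rightarrow> com \<Rightarrow> com" where
  "replace_queries b G (Query x y) =
     Seq (Assign (Suc b) (Var y)) (Seq G (Assign x (Var (Suc b))))"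
| "replace_queries b G (Seq c d) = Seq (replace_queries b G c) (replace_queries b G d)"
| "replace_queries b G (Cond e c d) = Cond e (replace_queries b G c) (replace_queries b G d)"
| "replace_queries b G (While e c) = While e (replace_queries b G c)"
| "replace_queries b G c = c"

lemma oracle_free_replace_queries:
  "oracle_free G \<Longrightarrow> oracle_free (replace_queries b G c)"
  by (induction c) auto

text \<open>The answers may grow along a chain of queries, each being fed into the next.  Since an
  answer exceeds its query by at most \<open>K\<close>, the values stay below \<open>M + K * t\<close> after time \<open>t\<close>.\<close>

lemma exec_size:
  assumes g: "\<And>d. size (g d) \<le> size d + K" and K: "K \<ge> 1"
  shows "exec g c s t s' \<Longrightarrow> (\<And>x. size (s x) \<le> M) \<Longrightarrow> size (s' x) \<le> M + K * t"
proof (induction arbitrary: M x rule: exec.induct)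
  case (exec_Assign y e s)
  have "size (eval_exp e s) \<le> K * Suc (cost e s)"
    using size_eval_exp[of e s] K by (cases K) auto
  then show ?case
    using exec_Assign[of x] by (simp add: trans_le_add1 trans_le_add2)
next
  case (exec_Query x' y s)
  have "size (s y) \<le> M" "size (s x) \<le> M"
    by (rule exec_Query)+
  then show ?case
    using g[of "s y"] by (cases "x = x'") auto
next
  case (exec_Seq c s t s' d u s'')
  have "size (s'' x) \<le> (M + K * t) + K * u"
    using exec_Seq.IH exec_Seq.prems by blast
  then show ?case by (simp add: algebra_simps)
next
  case (exec_WhileT e s c t s' u s'')
  have "size (s'' x) \<le> (M + K * t) + K * u"
    using exec_WhileT.IH exec_WhileT.prems by blast
  then show ?case by (simp add: algebra_simps)
next
  case (exec_CondT e s c t s' d)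
  have "size (s' x) \<le> M + K * t"
    using exec_CondT.IH exec_CondT.prems by blast
  then show ?case by (simp add: algebra_simps)
next
  case (exec_CondF e s d t s' c)
  have "size (s' x) \<le> M + K * t"
    using exec_CondF.IH exec_CondF.prems by blast
  then show ?case by (simp add: algebra_simps)
qed (auto intro: trans_le_add1)

text \<open>\<open>M\<close> bounds the store at the start of the run, \<open>N\<close> all values
  until its end. A query then costs at most \<open>2 * N + q N + 10\<close> (copy in, subroutine,
  copy out), and every other step is charged the same factor.\<close>

lemma runs_replace_queries:
  assumes g: "\<And>d. size (g d) \<le> size d + K" and K: "K \<ge> 1"
    and G: "implements G (Suc b) g q" and q: "growth q"
  shows "exec g c s t s' \<Longrightarrow> vars_com c \<subseteq> {..<b} \<Longrightarrow> (\<And>x. size (s x) \<le> M) \<Longrightarrow> M + K * t \<le> N \<Longrightarrow>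
    (\<And>x. x < b \<Longrightarrow> u x = s x) \<Longrightarrow>
    runs (replace_queries b G c) u (t * (2 * N + q N + 10))
      (\<lambda>u'. u' b = u b \<and> (\<forall>x<b. u' x = s' x))"
proof (induction arbitrary: M u rule: exec.induct)
  case (exec_Skip s)
  then show ?case by (auto intro: runsI[OF exec.exec_Skip])
next
  case (exec_Assign x e s)
  have "\<And>x. x \<in> vars_exp e \<Longrightarrow> s x = u x"
    using exec_Assign.prems by auto
  then have "eval_exp e u = eval_exp e s" "cost e u = cost e s"
    using eval_exp_cong cost_cong by metis+
  moreover have "Suc (cost e s) * 1 \<le> Suc (cost e s) * (2 * N + q N + 10)"
    by (rule mult_le_mono2) simp
  ultimately show ?case
    unfolding replace_queries.simps using exec_Assign.prems
    by (intro runs_Assign) (simp only: mult_1_right, auto)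
next
  case (exec_Query x y s)
  have xy: "x < b" "y < b" "u y = s y" "size (s y) + K \<le> N"
    using exec_Query.prems(1,3,4) exec_Query.prems(2)[of y] by auto
  have "runs (replace_queries b G (Query x y)) u ((2 + N) + (q N + (2 + N)))
      (\<lambda>u'. u' b = u b \<and> (\<forall>z<b. u' z = (s(x := g (s y))) z))"
    unfolding replace_queries.simps
    by (intro runs_Seq runs_Assign implementsD[OF G _ q])
      (use xy exec_Query.prems(4) g[of "s y"] in auto)
  then show ?case
    by (rule runs_mono) auto
next
  case (exec_Seq c s t s' d v s'')
  \<comment> \<open>The second part starts with values up to \<open>M + K * t\<close>; as times add
    up, the same \<open>N\<close> still covers its run.\<close>
  have sz: "size (s' x) \<le> M + K * t" for x
    using exec_size[OF g K exec_Seq.hyps(1)] exec_Seq.prems(2) by blast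
  have IH2: "runs (replace_queries b G d) u' (v * (2 * N + q N + 10))
      (\<lambda>u''. u'' b = u b \<and> (\<forall>x<b. u'' x = s'' x))"
    if "u' b = u b \<and> (\<forall>x<b. u' x = s' x)" for u'
    using exec_Seq.IH(2)[of "M + K * t" u'] sz exec_Seq.prems that by (simp add: algebra_simps)
  have "runs (replace_queries b G c) u (t * (2 * N + q N + 10)) (\<lambda>u'. u' b = u b \<and> (\<forall>x<b. u' x = s' x))"
    using exec_Seq.IH(1)[of M u] exec_Seq.prems by (simp add: algebra_simps)
  then have "runs (replace_queries b G (Seq c d)) u (t * (2 * N + q N + 10) + v * (2 * N + q N + 10))
      (\<lambda>u''. u'' b = u b \<and> (\<forall>x<b. u'' x = s'' x))"
    unfolding replace_queries.simps by (intro runs_Seq) (rule runs_mono[OF _ order_refl], assumption, rule IH2)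
  then show ?case
    by (simp add: algebra_simps)
next
  case (exec_CondT e s c t s' d)
  have "\<And>x. x \<in> vars_exp e \<Longrightarrow> s x = u x"
    using exec_CondT.prems by auto
  then have e: "eval_exp e u = eval_exp e s" "cost e u = cost e s"
    using eval_exp_cong cost_cong by metis+
  have "runs (replace_queries b G c) u (t * (2 * N + q N + 10)) (\<lambda>u'. u' b = u b \<and> (\<forall>x<b. u' x = s' x))"
    using exec_CondT.IH[of M u] exec_CondT.prems by (simp add: algebra_simps)
  then have "runs (replace_queries b G (Cond e c d)) u (Suc (cost e u + t * (2 * N + q N + 10)))
      (\<lambda>u'. u' b = u b \<and> (\<forall>x<b. u' x = s' x))"
    unfolding replace_queries.simps using exec_CondT.hyps(1) e by (intro runs_Cond) simp
  then show ?case
    by (rule runs_mono) (auto simp: e algebra_simps)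
next
  case (exec_CondF e s d t s' c)
  have "\<And>x. x \<in> vars_exp e \<Longrightarrow> s x = u x"
    using exec_CondF.prems by auto
  then have e: "eval_exp e u = eval_exp e s" "cost e u = cost e s"
    using eval_exp_cong cost_cong by metis+
  have "runs (replace_queries b G d) u (t * (2 * N + q N + 10)) (\<lambda>u'. u' b = u b \<and> (\<forall>x<b. u' x = s' x))"
    using exec_CondF.IH[of M u] exec_CondF.prems by (simp add: algebra_simps)
  then have "runs (replace_queries b G (Cond e c d)) u (Suc (cost e u + t * (2 * N + q N + 10)))
      (\<lambda>u'. u' b = u b \<and> (\<forall>x<b. u' x = s' x))"
    unfolding replace_queries.simps using exec_CondF.hyps(1) e by (intro runs_Cond) simp
  then show ?case
    by (rule runs_mono) (auto simp: e algebra_simps)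
next
  case (exec_WhileF e s c)
  have "\<And>x. x \<in> vars_exp e \<Longrightarrow> s x = u x"
    using exec_WhileF.prems by auto
  then have e: "eval_exp e u = eval_exp e s" "cost e u = cost e s"
    using eval_exp_cong cost_cong by metis+
  have "runs (replace_queries b G (While e c)) u (Suc (cost e u))
      (\<lambda>u'. u' b = u b \<and> (\<forall>x<b. u' x = s x))"
    unfolding replace_queries.simps
    using exec_WhileF.hyps e exec_WhileF.prems by (intro runs_WhileF) auto
  moreover have "Suc (cost e s) * 1 \<le> Suc (cost e s) * (2 * N + q N + 10)"
    by (rule mult_le_mono2) simp
  ultimately show ?case
    by (elim runs_mono) (simp only: e mult_1_right, auto)
next
  case (exec_WhileT e s c t s' v s'')
  have "\<And>x. x \<in> vars_exp e \<Longrightarrow> s x = u x"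
    using exec_WhileT.prems by auto
  then have e: "eval_exp e u = eval_exp e s" "cost e u = cost e s"
    using eval_exp_cong cost_cong by metis+
  have sz: "size (s' x) \<le> M + K * t" for x
    using exec_size[OF g K exec_WhileT.hyps(2)] exec_WhileT.prems(2) by blast
  have IH2: "runs (replace_queries b G (While e c)) u' (v * (2 * N + q N + 10))
      (\<lambda>u''. u'' b = u b \<and> (\<forall>x<b. u'' x = s'' x))"
    if "u' b = u b \<and> (\<forall>x<b. u' x = s' x)" for u'
    using exec_WhileT.IH(2)[of "M + K * t" u'] sz exec_WhileT.prems that by (simp add: algebra_simps)
  have "runs (replace_queries b G c) u (t * (2 * N + q N + 10)) (\<lambda>u'. u' b = u b \<and> (\<forall>x<b. u' x = s' x))"
    using exec_WhileT.IH(1)[of M u] exec_WhileT.prems by (simp add: algebra_simps)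
  then have "runs (replace_queries b G (While e c)) u
      (Suc (cost e u + t * (2 * N + q N + 10) + v * (2 * N + q N + 10)))
      (\<lambda>u''. u'' b = u b \<and> (\<forall>x<b. u'' x = s'' x))"
    unfolding replace_queries.simps using exec_WhileT.hyps(1) e
    by (intro runs_WhileT) (auto elim!: runs_mono intro!: IH2[unfolded replace_queries.simps])
  then show ?case
    by (rule runs_mono) (auto simp: e algebra_simps)
qed

text \<open>Variable \<open>b\<close> keeps the input while the program \<open>c\<close> runs on the variables below \<open>b\<close>.\<close>

lemma oracle_free_pipeline:
  assumes pre: "ptime pre" and post: "ptime (\<lambda>z. post (hd_data z) (tl_data z))" and g: "ptime g"
    and gK: "\<And>d. size (g d) \<le> size d + K" and P: "growth P" and R: "growth R"
  shows "\<exists>c' p. oracle_free c' \<and> growth p \<and>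
    (\<forall>d t out. computes g c (pre d) t out \<longrightarrow> t \<le> P (size d) \<longrightarrow> size out \<le> R (size d) \<longrightarrow>
      (\<exists>t' \<le> p (size d). computes (\<lambda>_. Leaf) c' d t' (post d out)))"
proof -
  obtain qpre Pre where pre: "growth qpre" "\<And>d. size (pre d) \<le> qpre (size d)"
    "\<And>b. implements (Pre b) b pre qpre"
    by (rule ptimeE[OF pre]) (rule that)
  obtain qpost Post where post: "growth qpost"
    "\<And>z. size (post (hd_data z) (tl_data z)) \<le> qpost (size z)"
    "\<And>b. implements (Post b) b (\<lambda>z. post (hd_data z) (tl_data z)) qpost"
    by (rule ptimeE[OF post]) (rule that)
  obtain q G where g: "growth q" "\<And>d. size (g d) \<le> q (size d)" "\<And>b. implements (G b) b g q"
    by (rule ptimeE[OF g]) (rule that)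
  \<comment> \<open>At least 1, because variable 0 carries input and output.\<close>
  have "\<exists>b. vars_com c \<subseteq> {..<b} \<and> b \<ge> 1"
    using finite_nat_set_iff_bounded[of "insert 0 (vars_com c)"] finite_vars_com[of c]
    by (auto simp: subset_iff)
  then obtain b where b: "vars_com c \<subseteq> {..<b}" "b \<ge> 1"
    by blast
  \<comment> \<open>Values start with size at most \<open>qpre n\<close> and grow by at most
    \<open>Suc K\<close> per unit of time; the successor makes the increment positive, as the
    simulation demands.\<close>
  define N where "N n = qpre n + Suc K * P n" for n
  let ?c = "Seq (Assign b (Var 0)) (Seq (Assign (Suc b) (Var b)) (Seq (Pre (Suc b))
    (Seq (Assign 0 (Var (Suc b))) (Seq (replace_queries b (G (Suc b)) c)
    (Seq (Assign (Suc b) (Cons_exp (Var b) (Var 0))) (Seq (Post (Suc b)) (Assign 0 (Var (Suc b)))))))))"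
  let ?p = "\<lambda>n. (2 + n) + ((2 + n) + (qpre n + ((2 + qpre n) + (P n * (2 * N n + q (N n) + 10) +
      ((5 + 2 * n + 2 * R n) + (qpost (n + R n + 1) + (2 + qpost (n + R n + 1))))))))"
  have N: "growth N"
    unfolding N_def by (intro growth_intros pre(1) P)
  have "growth ?p"
    by (intro growth_intros pre(1) N P R growth_compose[OF g(1)] growth_compose[OF post(1)])
  moreover have "oracle_free ?c"
    using pre(3)[of "Suc b"] post(3)[of "Suc b"] g(3)[of "Suc b"]
    by (simp add: implements_def oracle_free_replace_queries)
  moreover have "\<exists>t' \<le> ?p (size d). computes (\<lambda>_. Leaf) ?c d t' (post d out)"
    if comp: "computes g c (pre d) t out" and t: "t \<le> P (size d)" and out: "size out \<le> R (size d)" for d t out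
  proof -
    let ?n = "size d"
    obtain s where s: "exec g c ((\<lambda>_. Leaf)(0 := pre d)) t s" "s 0 = out"
      using comp by (auto simp: computes_def)
    have sim: "runs (replace_queries b (G (Suc b)) c) u (P ?n * (2 * N ?n + q (N ?n) + 10))
       (\<lambda>u'. u' b = u b \<and> u' 0 = out)"
      if u: "\<And>x. x < b \<Longrightarrow> u x = ((\<lambda>_. Leaf)(0 := pre d)) x" for u
    proof -
      have "Suc K * t \<le> Suc K * P ?n"
        using t by (rule mult_left_mono) simp
      then have "runs (replace_queries b (G (Suc b)) c) u (t * (2 * N ?n + q (N ?n) + 10))
         (\<lambda>u'. u' b = u b \<and> (\<forall>x<b. u' x = s x))"
        by (intro runs_replace_queries[where M = "qpre ?n" and K = "Suc K", OF _ _ g(3) g(1) s(1) b(1) _ _ u])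
          (use pre(2)[of d] gK in \<open>auto simp: N_def intro: le_SucI\<close>)
      then show ?thesis
        by (rule runs_mono) (use t s b in \<open>auto intro: mult_right_mono\<close>)
    qed
    have post': "size (post d out) \<le> qpost (?n + R ?n + 1)"
    proof -
      have "size (post d out) \<le> qpost (size (Node d out))"
        using post(2)[of "Node d out"] by simp
      also have "\<dots> \<le> qpost (?n + R ?n + 1)"
        using out by (intro growth_mono[OF post(1)]) simp
      finally show ?thesis .
    qed
    have "runs ?c ((\<lambda>_. Leaf)(0 := d)) (?p ?n) (\<lambda>s. s 0 = post d out)"
    proof (intro runs_Seq runs_Assign implementsD[OF pre(3) _ pre(1)], goal_cases)
      case (5 s1)
      let ?u = "s1(0 := eval_exp (Var (Suc b)) s1)"
      \<comment> \<open>The simulated program expects its other variables to be \<open>Leaf\<close>;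
        this still holds because the preprocessing ran above \<open>b\<close>.\<close>
      have s1: "s1 b = d" "s1 (Suc b) = pre d" "\<And>x. x < b \<Longrightarrow> x \<noteq> 0 \<Longrightarrow> s1 x = Leaf"
        using 5 b(2) by auto
      have "runs (replace_queries b (G (Suc b)) c) ?u (P ?n * (2 * N ?n + q (N ?n) + 10))
       (\<lambda>u'. u' b = ?u b \<and> u' 0 = out)"
        by (rule sim) (use s1 in auto)
      then show ?case
      proof (rule runs_mono, goal_cases)
        case (2 s2)
        then have s2: "s2 b = d" "s2 0 = out"
          using s1 b(2) by auto
        show ?case
          by (intro runs_Seq runs_Assign implementsD[OF post(3) _ post(1)])
            (use s2 b(2) out post' in auto)
      qed simp
    qed (use b(2) pre(2)[of d] in auto)
    then show ?thesis
      by (auto simp: runs_def computes_def)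
  qed
  ultimately show ?thesis
    by blast
qed

section \<open>The poset of a hypergraph\<close>

text \<open>The label of a position is the set of elements strictly below it. A vertex and a copy of
  the empty hyperedge share the label \<open>{}\<close> and differ by position only.\<close>

definition labels :: "nat \<Rightarrow> nat set list \<Rightarrow> nat set list" where
  "labels n es = replicate n {} @ concat (replicate n es)"

text \<open>The poset consists of the \<open>n\<close> vertices, which are minimal, and \<open>n\<close> copies of each hyperedge
  above the vertices of that hyperedge.\<close>

definition edge_order :: "nat \<Rightarrow> nat set list \<Rightarrow> (nat \<times> nat) set" where
  "edge_order n es = {(y, x). x < length (labels n es) \<and> y < length (labels n es) \<and>
     (y = x \<or> y \<in> labels n es ! x)}"

definition vertex_weight :: "nat \<Rightarrow> nat \<Rightarrow> nat" where
  "vertex_weight n x = (if x < n then 1 else 0)"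

definition edge_copies :: "nat \<Rightarrow> nat set list \<Rightarrow> nat set \<Rightarrow> nat set" where
  "edge_copies n es U = {x. n \<le> x \<and> x < length (labels n es) \<and> labels n es ! x \<subseteq> U}"

lemma length_labels: "length (labels n es) = n * (length es + 1)"
  by (simp add: labels_def length_concat sum_list_replicate)

lemma labels_vertex: "x < n \<Longrightarrow> labels n es ! x = {}"
  by (simp add: labels_def nth_append)

lemma labels_subset:
  assumes "\<Union>(set es) \<subseteq> {..<n}" "x < length (labels n es)"
  shows "labels n es ! x \<subseteq> {..<n}"
proof -
  have "labels n es ! x \<in> set (labels n es)"
    using assms(2) by simp
  then show ?thesis
    using assms(1) by (auto simp: labels_def)
qed

text \<open>Members of labels are vertices and have empty labels themselves, so two proper
  comparisons never compose and chains have at most two elements.\<close>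

lemma partial_order_edge_order:
  assumes "\<Union>(set es) \<subseteq> {..<n}"
  shows "partial_order_on {..<length (labels n es)} (edge_order n es)"
proof -
  have lab: "labels n es ! y = {}" if "y \<in> labels n es ! x" "x < length (labels n es)" for x y
    using labels_subset[OF assms that(2)] that(1) by (metis labels_vertex lessThan_iff subsetD)
  have "trans (edge_order n es)"
    unfolding edge_order_def trans_def using lab by fastforce
  moreover have "antisym (edge_order n es)"
    unfolding edge_order_def antisym_def using lab by fastforce
  ultimately show ?thesis
    by (auto simp: partial_order_on_def preorder_on_def refl_on_def edge_order_def)
qed

lemma ideals_edge_order_iff:
  assumes "\<Union>(set es) \<subseteq> {..<n}"
  shows "S \<in> ideals {..<length (labels n es)} (edge_order n es) \<longleftrightarrow>
     S \<subseteq> {..<length (labels n es)} \<and> (\<forall>x\<in>S. labels n es ! x \<subseteq> S)"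
proof -
  have "n \<le> length (labels n es)"
    by (simp add: length_labels)
  then have lt: "y < length (labels n es)" if "y \<in> labels n es ! x" "x < length (labels n es)" for x y
    using labels_subset[OF assms that(2)] that(1) by auto
  show ?thesis
  proof
    assume S: "S \<in> ideals {..<length (labels n es)} (edge_order n es)"
    then have "S \<subseteq> {..<length (labels n es)}"
      by (auto simp: ideals_def)
    with S lt show "S \<subseteq> {..<length (labels n es)} \<and> (\<forall>x\<in>S. labels n es ! x \<subseteq> S)"
      unfolding ideals_def edge_order_def by blast
  next
    assume "S \<subseteq> {..<length (labels n es)} \<and> (\<forall>x\<in>S. labels n es ! x \<subseteq> S)"
    then show "S \<in> ideals {..<length (labels n es)} (edge_order n es)"
      by (auto simp: ideals_def edge_order_def)
  qed
qed

text \<open>Every added element gains exactly 1, so the two marginals compared by DR-submodularity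
  are equal.\<close>

lemma knapsack_instance_card:
  assumes "finite N" "partial_order_on N r" "\<And>x. x \<in> N \<Longrightarrow> w x \<in> {0, 1}"
  shows "knapsack_instance N r (\<lambda>S. real (card S)) w"
proof -
  have fin: "finite S" if "S \<in> ideals N r" for S
    using that assms(1) by (auto simp: ideals_def intro: finite_subset)
  have "DR_submodular N r (\<lambda>S. real (card S))"
    unfolding DR_submodular_def
  proof (intro ballI allI impI)
    fix S T x y
    assume "S \<in> ideals N r" "T \<in> ideals N r"
      "S \<subseteq> T \<and> (x, y) \<in> r \<and> x \<notin> S \<and> y \<notin> T \<and> insert x S \<in> ideals N r \<and> insert y T \<in> ideals N r"
    then show "real (card (insert y T)) - real (card T) \<le> real (card (insert x S)) - real (card S)"
      using fin[of S] fin[of T] by simp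
  qed
  moreover have "monotone_ideals N r (\<lambda>S. real (card S))"
    using fin by (auto simp: monotone_ideals_def intro: card_mono)
  ultimately show ?thesis
    using assms by (simp add: knapsack_instance_def)
qed

text \<open>Counting list positions separates the copies of a hyperedge; distinctness then
  identifies positions in \<open>es\<close> with hyperedges.\<close>

lemma card_edge_copies:
  assumes "distinct es"
  shows "card (edge_copies n es U) = n * card (induced_edges (set es) U)"
proof -
  let ?l = "concat (replicate n es)"
  have "edge_copies n es U = (\<lambda>i. n + i) ` {i. i < length ?l \<and> ?l ! i \<subseteq> U}"
  proof (intro equalityI subsetI)
    fix x
    assume "x \<in> edge_copies n es U"
    then have "x - n \<in> {i. i < length ?l \<and> ?l ! i \<subseteq> U}" "x = n + (x - n)"
      by (auto simp: edge_copies_def labels_def nth_append simp del: length_concat)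
    then show "x \<in> (\<lambda>i. n + i) ` {i. i < length ?l \<and> ?l ! i \<subseteq> U}"
      by blast
  qed (auto simp: edge_copies_def labels_def nth_append simp del: length_concat)
  then have "card (edge_copies n es U) = length (filter (\<lambda>e. e \<subseteq> U) ?l)"
    by (simp add: card_image length_filter_conv_card del: length_concat)
  also have "\<dots> = n * length (filter (\<lambda>e. e \<subseteq> U) es)"
    by (induction n) auto
  also have "length (filter (\<lambda>e. e \<subseteq> U) es) = card (induced_edges (set es) U)"
    using assms by (simp add: distinct_card[symmetric] induced_edges_def)
  finally show ?thesis .
qed

lemma sum_vertex_weight:
  "finite S \<Longrightarrow> (\<Sum>x\<in>S. vertex_weight n x) = card (S \<inter> {..<n})"
  by (simp add: vertex_weight_def sum.If_cases lessThan_def)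

text \<open>Provides the lower bound on the knapsack optimum: copies weigh 0, so the whole weight is
  that of \<open>U\<close>.\<close>

lemma edge_copies_ideal:
  assumes es: "\<Union>(set es) \<subseteq> {..<n}" "distinct es" and U: "U \<subseteq> {..<n}"
  shows "U \<union> edge_copies n es U \<in> knapsack_feasible {..<length (labels n es)} (edge_order n es)
      (vertex_weight n) (card U)"
    and "card (U \<union> edge_copies n es U) = card U + n * card (induced_edges (set es) U)"
proof -
  have fin: "finite U" "finite (edge_copies n es U)"
    using U by (auto simp: edge_copies_def intro: finite_subset)
  have "(U \<union> edge_copies n es U) \<inter> {..<n} = U"
    using U by (auto simp: edge_copies_def)
  moreover have "U \<union> edge_copies n es U \<in> ideals {..<length (labels n es)} (edge_order n es)"
    unfolding ideals_edge_order_iff[OF es(1)]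
    using U by (auto simp: edge_copies_def labels_vertex length_labels subset_iff)
  ultimately show "U \<union> edge_copies n es U \<in> knapsack_feasible {..<length (labels n es)}
      (edge_order n es) (vertex_weight n) (card U)"
    using fin by (simp add: knapsack_feasible_def sum_vertex_weight)
  have "U \<inter> edge_copies n es U = {}"
    using U by (auto simp: edge_copies_def)
  then show "card (U \<union> edge_copies n es U) = card U + n * card (induced_edges (set es) U)"
    using fin by (simp add: card_Un_disjoint card_edge_copies es(2))
qed

text \<open>The matching upper bound: labels consist of vertices, so a copy in \<open>S\<close> has
  its whole label in \<open>S \<inter> {..<n}\<close>.\<close>

lemma card_ideal_le:
  assumes es: "\<Union>(set es) \<subseteq> {..<n}" "distinct es"
    and S: "S \<in> ideals {..<length (labels n es)} (edge_order n es)"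
  shows "card S \<le> card (S \<inter> {..<n}) + n * card (induced_edges (set es) (S \<inter> {..<n}))"
proof -
  have "S \<subseteq> (S \<inter> {..<n}) \<union> edge_copies n es (S \<inter> {..<n})"
    using S labels_subset[OF es(1)] unfolding ideals_edge_order_iff[OF es(1)]
    by (auto simp: edge_copies_def subset_iff not_less)
  moreover have "finite ((S \<inter> {..<n}) \<union> edge_copies n es (S \<inter> {..<n}))"
    by (auto simp: edge_copies_def)
  ultimately have "card S \<le> card ((S \<inter> {..<n}) \<union> edge_copies n es (S \<inter> {..<n}))"
    by (simp add: card_mono)
  also have "\<dots> \<le> card (S \<inter> {..<n}) + card (edge_copies n es (S \<inter> {..<n}))"
    by (rule card_Un_le)
  finally show ?thesis
    by (simp add: card_edge_copies es(2))
qed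

section \<open>From ideals back to vertex sets\<close>

text \<open>Listing the members of \<open>U\<close> first makes the result contain the vertices in
  \<open>U\<close> whenever they fit. Otherwise they are cut down, so for \<open>k \<le> n\<close>
  the size is \<open>k\<close> in any case.\<close>

definition pad :: "nat \<Rightarrow> nat \<Rightarrow> nat set \<Rightarrow> nat set" where
  "pad n k U = set (take k (filter (\<lambda>x. x \<in> U) [0..<n] @ filter (\<lambda>x. x \<notin> U) [0..<n]))"

lemma pad_feasible:
  assumes "k \<le> n"
  shows "pad n k U \<in> subhypergraph_feasible {..<n} k"
proof -
  have "length (filter (\<lambda>x. x \<in> U) [0..<n]) + length (filter (\<lambda>x. x \<notin> U) [0..<n]) = n"
    using sum_length_filter_compl[of "\<lambda>x. x \<in> U" "[0..<n]"] by simp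
  moreover have "distinct (filter (\<lambda>x. x \<in> U) [0..<n] @ filter (\<lambda>x. x \<notin> U) [0..<n])"
    by auto
  from distinct_card[OF distinct_take[OF this, of k]] have "card (pad n k U) =
      min k (length (filter (\<lambda>x. x \<in> U) [0..<n]) + length (filter (\<lambda>x. x \<notin> U) [0..<n]))"
    unfolding pad_def by (simp only: length_take length_append min.commute)
  ultimately have "card (pad n k U) = k"
    using assms by simp
  moreover have "pad n k U \<subseteq> {..<n}"
    unfolding pad_def by (rule order_trans[OF set_take_subset]) auto
  ultimately show ?thesis
    by (simp add: subhypergraph_feasible_def)
qed

lemma subset_pad:
  assumes "card (U \<inter> {..<n}) \<le> k"
  shows "U \<inter> {..<n} \<subseteq> pad n k U"
proof -
  have "set (filter (\<lambda>x. x \<in> U) [0..<n]) = U \<inter> {..<n}"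
    by auto
  then have "length (filter (\<lambda>x. x \<in> U) [0..<n]) \<le> k"
    using assms distinct_card[of "filter (\<lambda>x. x \<in> U) [0..<n]"] by simp
  then show ?thesis
    by (auto simp: pad_def)
qed

text \<open>A candidate containing a hyperedge is frozen; otherwise \<open>e\<close> is tried
  without testing its size, being padded or cut to \<open>k\<close> vertices.\<close>

definition improve :: "nat \<Rightarrow> nat \<Rightarrow> nat set list \<Rightarrow> nat set \<Rightarrow> nat set \<Rightarrow> nat set" where
  "improve n k es e W = (if \<exists>e'\<in>set es. e' \<subseteq> W then W else pad n k e)"

lemma fold_improve_id:
  "\<exists>e\<in>set es. e \<subseteq> W \<Longrightarrow> fold (improve n k es) xs W = W"
  by (induction xs) (auto simp: improve_def)

lemma fold_improve_feasible:
  assumes "k \<le> n" "W \<in> subhypergraph_feasible {..<n} k"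
  shows "fold (improve n k es) xs W \<in> subhypergraph_feasible {..<n} k"
  using assms(2) by (induction xs arbitrary: W) (auto simp: improve_def pad_feasible[OF assms(1)])

text \<open>At the latest when \<open>e\<close> comes up the candidate contains a hyperedge, because
  padding keeps all of \<open>e\<close>; from then on it is frozen.\<close>

lemma fold_improve_contains_edge:
  assumes "\<Union>(set es) \<subseteq> {..<n}" "set xs \<subseteq> set es" "e \<in> set xs" "card e \<le> k"
  shows "\<exists>e\<in>set es. e \<subseteq> fold (improve n k es) xs W"
  using assms(2,3)
proof (induction xs arbitrary: W)
  case (Cons x xs)
  show ?case
  proof (cases "\<exists>e\<in>set es. e \<subseteq> improve n k es x W")
    case True
    then show ?thesis
      using fold_improve_id[OF True] by simp
  next
    case False
    have "x \<noteq> e"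
    proof
      assume "x = e"
      then have "e \<inter> {..<n} = e"
        using Cons.prems assms(1) by auto
      then have "e \<subseteq> pad n k e"
        using subset_pad[of e n k] assms(4) by simp
      then show False
        using False \<open>x = e\<close> Cons.prems by (auto simp: improve_def split: if_splits)
    qed
    then show ?thesis
      using Cons by auto
  qed
qed simp

text \<open>With \<open>U\<close> optimal and \<open>W\<close> the set returned, \<open>n * e(U)
  \<le> k + n * e(U) \<le> \<alpha> * card S \<le> 2 * \<alpha> * n * e(W)\<close> if
  \<open>e(U) > 0\<close>, and \<open>n\<close> cancels. The cancellation is why
  \<open>n = 0\<close> has a hypothesis of its own.\<close>

lemma approx_solution_improve:
  assumes es: "\<Union>(set es) \<subseteq> {..<n}" "distinct es" and k: "k \<le> n"
    and \<alpha>: "\<alpha> > 0" "n = 0 \<Longrightarrow> \<alpha> \<ge> 1"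
    and S: "approx_solution \<alpha> (knapsack_feasible {..<length (labels n es)} (edge_order n es)
       (vertex_weight n) k) (\<lambda>S. real (card S)) S"
  shows "approx_solution (2 * \<alpha>) (subhypergraph_feasible {..<n} k)
     (\<lambda>U. real (card (induced_edges (set es) U))) (fold (improve n k es) es (pad n k S))"
proof -
  let ?W = "fold (improve n k es) es (pad n k S)"
  let ?e = "\<lambda>U. card (induced_edges (set es) U)"
  let ?F = "knapsack_feasible {..<length (labels n es)} (edge_order n es) (vertex_weight n) k"
  let ?H = "subhypergraph_feasible {..<n} k"
  have e_mono: "?e U \<le> ?e U'" if "U \<subseteq> U'" for U U'
    using that by (intro card_mono) (auto simp: induced_edges_def)
  have e_pos: "?e U > 0 \<longleftrightarrow> (\<exists>e\<in>set es. e \<subseteq> U)" for U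
    by (auto simp: card_gt_0_iff induced_edges_def)
  have W: "?W \<in> ?H"
    by (intro fold_improve_feasible pad_feasible k)
  have "Max ((\<lambda>U. real (?e U)) ` ?H) \<in> (\<lambda>U. real (?e U)) ` ?H"
    using feasible_finite_nonempty(3)[of "{..<n}" k] feasible_finite_nonempty(4)[of k "{..<n}"] k by (intro Max_in) auto
  then obtain U where U: "U \<in> ?H" "Max ((\<lambda>U. real (?e U)) ` ?H) = real (?e U)"
    by blast
  then have U': "U \<subseteq> {..<n}" "card U = k"
    by (auto simp: subhypergraph_feasible_def)
  have opt: "real k + real n * real (?e U) \<le> \<alpha> * real (card S)"
  proof -
    let ?T = "U \<union> edge_copies n es U"
    have "real (card ?T) \<le> Max ((\<lambda>S. real (card S)) ` ?F)"
      using edge_copies_ideal(1)[OF es U'(1)] feasible_finite_nonempty(1)[of "{..<length (labels n es)}"]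
      by (intro Max_ge) (auto simp: U'(2))
    also have "\<dots> \<le> \<alpha> * real (card S)"
      using S \<alpha>(1) by (simp add: approx_solution_def field_simps)
    finally show ?thesis
      by (simp add: edge_copies_ideal(2)[OF es U'(1)] U'(2))
  qed
  let ?V = "S \<inter> {..<n}"
  have Sid: "S \<in> ideals {..<length (labels n es)} (edge_order n es)" "card ?V \<le> k"
  proof -
    have SF: "S \<in> ?F"
      using S by (simp add: approx_solution_def)
    then show "S \<in> ideals {..<length (labels n es)} (edge_order n es)"
      by (simp add: knapsack_feasible_def)
    then have "finite S"
      by (auto simp: ideals_def intro: finite_subset)
    with SF show "card ?V \<le> k"
      by (simp add: knapsack_feasible_def sum_vertex_weight)
  qed
  have pad: "?V \<subseteq> pad n k S"
    by (rule subset_pad[OF Sid(2)])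
  have upper: "real (card S) \<le> real k + real n * real (?e ?V)"
    using card_ideal_le[OF es Sid(1)] Sid(2)
    by (metis (mono_tags, lifting) add_le_mono1 le_trans of_nat_add of_nat_le_iff of_nat_mult)
  have "real (?e U) \<le> 2 * \<alpha> * real (?e ?W)"
  proof (cases "?e U = 0 \<or> n = 0")
    case True
    \<comment> \<open>The poset is then empty and says nothing about the hypergraph, yet the edge
      set \<open>{{}}\<close> has optimum 1; \<open>{}\<close> is the only feasible set.\<close>
    have "?W = U" if "n = 0"
      using that W U(1) by (simp add: subhypergraph_feasible_def)
    moreover have "1 * real (?e U) \<le> 2 * \<alpha> * real (?e U)" if "n = 0"
      using \<alpha>(2)[OF that] by (intro mult_right_mono) auto
    ultimately show ?thesis
      using True \<alpha>(1) by (cases "n = 0") auto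
  next
    case False
    then obtain e where e: "e \<in> set es" "e \<subseteq> U"
      using e_pos[of U] by auto
    have "card e \<le> k"
      using e(2) U' by (metis card_mono finite_lessThan finite_subset)
    then have "\<exists>e\<in>set es. e \<subseteq> ?W"
      using fold_improve_contains_edge[OF es(1) order_refl e(1)] by blast
    then have W1: "?e ?W \<ge> 1"
      using e_pos[of ?W] by simp
    \<comment> \<open>If the padded set contains a hyperedge, it is the set returned, and both
      \<open>k \<le> n\<close> and \<open>n * e(V)\<close>, for \<open>V\<close> the vertices in
      \<open>S\<close>, are at most \<open>n * e(W)\<close>. Otherwise \<open>e(V) = 0\<close>, so
      \<open>card S \<le> k\<close>.\<close>
    have "real (card S) \<le> 2 * (real n * real (?e ?W))"
    proof (cases "\<exists>e\<in>set es. e \<subseteq> pad n k S")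
      case True
      have "?e ?V \<le> ?e ?W"
        unfolding fold_improve_id[OF True] by (rule e_mono[OF pad])
      then have "real n * real (?e ?V) \<le> real n * real (?e ?W)"
        by (intro mult_left_mono) auto
      moreover have "real n * 1 \<le> real n * real (?e ?W)"
        using W1 by (intro mult_left_mono) auto
      ultimately show ?thesis
        using upper k by simp
    next
      case False
      then have "\<not> ?e ?V > 0"
        unfolding e_pos using pad by blast
      then have "real (card S) \<le> real n * 1"
        using upper k by simp
      also have "\<dots> \<le> real n * (2 * real (?e ?W))"
        using W1 by (intro mult_left_mono) auto
      finally show ?thesis by simp
    qed
    then have "\<alpha> * real (card S) \<le> \<alpha> * (2 * (real n * real (?e ?W)))"
      using \<alpha>(1) by (intro mult_left_mono) auto
    then have "real n * real (?e U) \<le> real n * (2 * \<alpha> * real (?e ?W))"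
      using opt by (simp add: algebra_simps)
    then show ?thesis
      using False by simp
  qed
  then show ?thesis
    using W U(2) \<alpha>(1) by (simp add: approx_solution_def field_simps)
qed

text \<open>For a constant objective every feasible set is optimal, so a factor below 1 would demand
  a value above the optimum. The constant 1 works on the empty poset too, where cardinality would
  have optimum 0.\<close>

lemma knapsack_approximation_ge_1:
  assumes "knapsack_approximation c \<alpha>" "\<alpha> n > 0"
  shows "\<alpha> n \<ge> 1"
proof -
  have "knapsack_instance {..<n} (Id_on {..<n}) (\<lambda>_. 1) (\<lambda>_. 0)"
    by (auto simp: knapsack_instance_def monotone_ideals_def DR_submodular_def partial_order_on_def
        preorder_on_def refl_on_def trans_def antisym_def)
  moreover have "value_oracle n (Id_on {..<n}) (\<lambda>_. 1) (\<lambda>_. Node (enc_nat 1) (enc_nat 1))"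
    by (auto simp: value_oracle_def encodes_value_def intro!: exI[of _ 1])
  ultimately obtain S where
    "approx_solution (\<alpha> n) (knapsack_feasible {..<n} (Id_on {..<n}) (\<lambda>_. 0) 0) (\<lambda>_. 1) S"
    using assms(1) unfolding knapsack_approximation_def by blast
  then have "S \<in> knapsack_feasible {..<n} (Id_on {..<n}) (\<lambda>_. 0) 0"
    "1 / \<alpha> n * Max ((\<lambda>_. 1) ` knapsack_feasible {..<n} (Id_on {..<n}) (\<lambda>_. 0) 0) \<le> 1"
    by (auto simp: approx_solution_def)
  then have "1 / \<alpha> n * Max {1} \<le> 1"
    by (metis image_constant)
  with assms(2) show ?thesis
    by (simp add: field_simps)
qed

section \<open>The reduction as a polynomial-time function\<close>

text \<open>A bit vector that is too short is read as if it were extended by zeros.\<close>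

abbreviation has_bit :: "data \<Rightarrow> data \<Rightarrow> bool" where
  "has_bit y c \<equiv> nth_data y c \<noteq> Leaf"

lemma bit_enc_set: "has_bit (unary y) (enc_set n U) \<longleftrightarrow> y < n \<and> y \<in> U"
  by (simp add: enc_set_def nth_data_enc_list)

lemma bit_Leaf: "\<not> has_bit (unary y) Leaf"
  using nth_data_enc_list[of y "[]"] by simp

lemma size_enc_set: "size (enc_set n S) \<le> 2 * n"
proof -
  have "size (enc_set n S) \<le> length (map (\<lambda>i. enc_bool (i \<in> S)) [0..<n]) * Suc 1"
    unfolding enc_set_def by (rule size_enc_list_le) (auto intro: size_enc_bool[unfolded One_nat_def])
  then show ?thesis by simp
qed

definition vertices :: "data \<Rightarrow> data list" where
  "vertices d = dec_list (hd_data d)"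

definition edges :: "data \<Rightarrow> data list" where
  "edges d = dec_list (hd_data (tl_data d))"

definition budget :: "data \<Rightarrow> data" where
  "budget d = tl_data (tl_data d)"

text \<open>The vertex vector serves merely as a counter of length \<open>n\<close>.
  \<open>Leaf\<close> represents the empty set, and edge vectors of length \<open>n\<close> read as
  0 at the positions of copies.\<close>

definition label_data :: "data \<Rightarrow> data list" where
  "label_data d = map (\<lambda>_. Leaf) (vertices d) @ concat (map (\<lambda>_. edges d) (vertices d))"

definition order_data :: "data \<Rightarrow> data list" where
  "order_data d = map (\<lambda>x. enc_list (map (\<lambda>y. enc_bool (y = x \<or> has_bit y (nth_data x (enc_list (label_data d)))))
     (indices (label_data d)))) (indices (label_data d))"

definition weight_data :: "data \<Rightarrow> data list" where
  "weight_data d = map (\<lambda>_. enc_nat 1) (vertices d) @ concat (map (\<lambda>_. map (\<lambda>_. enc_nat 0) (edges d)) (vertices d))"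

definition reduction :: "data \<Rightarrow> data" where
  "reduction d = Node (enc_list (order_data d)) (Node (enc_list (weight_data d)) (budget d))"

lemma ptime_reduction: "ptime reduction"
proof -
  have "ptime (\<lambda>d. reduction d)"
    unfolding reduction_def order_data_def weight_data_def label_data_def vertices_def edges_def budget_def
    by (intro ptime_intros)
  then show ?thesis .
qed

lemma hypergraph_data:
  "vertices (enc_hypergraph n es k) = replicate n (enc_bool True)"
  "edges (enc_hypergraph n es k) = map (enc_set n) es"
  "budget (enc_hypergraph n es k) = enc_nat k"
  by (simp_all add: vertices_def edges_def budget_def enc_hypergraph_def enc_set_def
      map_replicate_const list_eq_iff_nth_eq)

lemma length_label_data:
  "length (label_data (enc_hypergraph n es k)) = length (labels n es)"
  by (simp add: label_data_def hypergraph_data length_labels length_concat sum_list_replicate)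

text \<open>Bit vectors and sets are related entry by entry, and \<open>list_all2\<close> carries
  this relation through appending and replication.\<close>

lemma bit_label_data:
  assumes "\<Union>(set es) \<subseteq> {..<n}" "x < length (labels n es)"
  shows "has_bit (unary y) (label_data (enc_hypergraph n es k) ! x) \<longleftrightarrow> y \<in> labels n es ! x"
proof -
  let ?R = "\<lambda>c U. \<forall>y. has_bit (unary y) c \<longleftrightarrow> y \<in> U"
  have es: "list_all2 ?R (map (enc_set n) es) es"
    unfolding list.rel_map by (rule list.rel_refl_strong) (use assms(1) in \<open>auto simp: bit_enc_set\<close>)
  have "list_all2 ?R (concat (replicate m (map (enc_set n) es))) (concat (replicate m es))" for m
    by (induction m) (auto intro: list_all2_appendI es)
  moreover have "list_all2 ?R (replicate n Leaf) (replicate n {})"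
    by (auto simp: list_all2_conv_all_nth bit_Leaf simp del: not_not)
  ultimately have "list_all2 ?R (label_data (enc_hypergraph n es k)) (labels n es)"
    unfolding label_data_def labels_def hypergraph_data
    by (simp add: list_all2_appendI map_replicate_const)
  with assms(2) show ?thesis
    by (auto simp: list_all2_conv_all_nth)
qed

lemma order_data_enc_hypergraph:
  assumes "\<Union>(set es) \<subseteq> {..<n}"
  shows "order_data (enc_hypergraph n es k) =
     map (\<lambda>x. enc_set (length (labels n es)) {y. (y, x) \<in> edge_order n es}) [0..<length (labels n es)]"
  by (auto simp: order_data_def indices_def length_label_data enc_set_def nth_data_enc_list
      bit_label_data[OF assms] edge_order_def intro!: arg_cong[where f = enc_list] arg_cong[where f = enc_bool])

lemma weight_data_enc_hypergraph:
  "weight_data (enc_hypergraph n es k) =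
     map (\<lambda>x. enc_nat (vertex_weight n x)) [0..<length (labels n es)]"
proof -
  have "length (labels n es) = n + n * length es"
    by (simp add: length_labels)
  then have "[0..<length (labels n es)] = [0..<n] @ [n..<length (labels n es)]"
    using upt_add_eq_append[of 0 n "n * length es"] by simp
  moreover have "map (\<lambda>x. enc_nat (vertex_weight n x)) [0..<n] = replicate n (enc_nat 1)"
    by (simp add: list_eq_iff_nth_eq vertex_weight_def)
  moreover have "map (\<lambda>x. enc_nat (vertex_weight n x)) [n..<length (labels n es)] =
      replicate (n * length es) (enc_nat 0)"
    by (rule replicate_eqI) (auto simp: vertex_weight_def length_labels)
  moreover have "concat (replicate m (replicate (length es) (enc_nat 0))) = replicate (m * length es) (enc_nat 0)" for m
    by (induction m) (simp_all add: replicate_add)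
  ultimately show ?thesis
    by (simp add: weight_data_def hypergraph_data map_replicate_const)
qed

lemma reduction_enc_hypergraph:
  assumes "\<Union>(set es) \<subseteq> {..<n}"
  shows "reduction (enc_hypergraph n es k) =
     enc_knapsack (length (labels n es)) (edge_order n es) (vertex_weight n) k"
  by (simp add: reduction_def enc_knapsack_def order_data_enc_hypergraph[OF assms]
      weight_data_enc_hypergraph hypergraph_data)

text \<open>Bounds the number of poset elements, and with it oracle answers and output, by the size
  of the reduced input.\<close>

lemma length_le_size_enc_knapsack: "n \<le> size (enc_knapsack n r w B)"
  using size_enc_list_ge[of "map (\<lambda>x. enc_set n {y. (y, x) \<in> r}) [0..<n]"]
  by (simp add: enc_knapsack_def)

section \<open>Cardinality as a value oracle\<close>

definition card_oracle :: "data \<Rightarrow> data" where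
  "card_oracle d = Node (count_true d) (enc_nat 1)"

lemma ptime_card_oracle: "ptime card_oracle"
proof -
  have "ptime (\<lambda>d. card_oracle d)"
    unfolding card_oracle_def by (intro ptime_intros ptime_count_true)
  then show ?thesis .
qed

text \<open>An additive bound, as the simulation requires; the 3 is one node plus the denominator 1
  of size 2.\<close>

lemma size_card_oracle: "size (card_oracle d) \<le> size d + 3"
  using size_count_true[of d] size_enc_nat[of 1] by (simp add: card_oracle_def)

lemma value_oracle_card: "value_oracle n r (\<lambda>S. real (card S)) card_oracle"
  unfolding value_oracle_def
proof
  fix S
  assume "S \<in> ideals {..<n} r"
  then have "S \<subseteq> {..<n}"
    by (simp add: ideals_def)
  then have "set (filter (\<lambda>i. i \<in> S) [0..<n]) = S"
    by auto
  then have "length (filter (\<lambda>i. i \<in> S) [0..<n]) = card S"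
    using distinct_card[of "filter (\<lambda>i. i \<in> S) [0..<n]"] by simp
  then have "card_oracle (enc_set n S) = Node (enc_nat (card S)) (enc_nat 1)"
    by (simp add: card_oracle_def enc_set_def count_true_enc_list filter_map comp_def)
  then show "encodes_value (card_oracle (enc_set n S)) (real (card S))"
    unfolding encodes_value_def by (intro exI[of _ "card S"] exI[of _ 1]) simp
qed

lemma max_answer_size_card: "max_answer_size n r card_oracle \<le> 2 * n + 3"
  unfolding max_answer_size_def
proof (rule Max.boundedI)
  show "(\<lambda>S. size (card_oracle (enc_set n S))) ` ideals {..<n} r \<noteq> {}"
    by (auto simp: ideals_def)
  show "m \<le> 2 * n + 3" if "m \<in> (\<lambda>S. size (card_oracle (enc_set n S))) ` ideals {..<n} r" for m
    using that order_trans[OF size_card_oracle add_right_mono[OF size_enc_set]] by auto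
qed (simp add: finite_ideals)

section \<open>Recovering the vertex set on trees\<close>

definition pick_step :: "data \<Rightarrow> data \<Rightarrow> data \<Rightarrow> data" where
  "pick_step K y z = (if hd_data z = K then z else Node (inc (hd_data z)) (Node y (tl_data z)))"

text \<open>The number of elements is given in binary and cannot drive a loop, so the fold runs over
  the list and counts in binary. Comparing trees suffices, as \<open>enc_nat\<close> is
  injective.\<close>

definition pick :: "data \<Rightarrow> data list \<Rightarrow> data" where
  "pick K ys = tl_data (fold (pick_step K) ys (Node (enc_nat 0) Leaf))"

lemma pick_enc_nat: "pick (enc_nat k) ys = enc_list (rev (take k ys))"
proof -
  \<comment> \<open>Invariant with \<open>i\<close> elements still to take; the final counter is
    left open because the list may be too short.\<close>
  have "\<exists>j. fold (pick_step (enc_nat k)) ys (Node (enc_nat (k - i)) (enc_list zs)) =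
      Node (enc_nat j) (enc_list (rev (take i ys) @ zs))" if "i \<le> k" for i zs
    using that
  proof (induction ys arbitrary: i zs)
    case (Cons y ys)
    show ?case
    proof (cases i)
      case 0
      then show ?thesis
        using Cons.IH[of 0 zs] by (simp add: pick_step_def)
    next
      case (Suc i')
      then have "enc_nat (k - i) \<noteq> enc_nat k" "Suc (k - i) = k - i'"
        using Cons.prems enc_nat_inj[of "k - i" k] by auto
      then have "pick_step (enc_nat k) y (Node (enc_nat (k - i)) (enc_list zs)) =
          Node (enc_nat (k - i')) (enc_list (y # zs))"
        by (simp add: pick_step_def inc_enc_nat)
      then show ?thesis
        using Cons.IH[of i' "y # zs"] Cons.prems Suc by simp
    qed
  qed auto
  from this[of k "[]"] show ?thesis
    by (auto simp: pick_def)
qed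

lemma ptime_pick:
  assumes K: "ptime K" and l: "ptime (\<lambda>d. enc_list (l d))"
  shows "ptime (\<lambda>d. pick (K d) (l d))"
proof -
  obtain q where q: "growth q" "\<And>d x. x \<in> set (l d) \<Longrightarrow> size x \<le> q (size d)"
    by (rule ptime_size_bound2[OF _ l, of "\<lambda>_ x. x"]) (intro ptime_basic_intros, rule that)
  have "ptime (\<lambda>d. fold (\<lambda>y z. pick_step (K d) y z) (l d) (Node (enc_nat 0) Leaf))"
  proof (rule ptime_fold_additive[OF _ l])
    show "ptime (\<lambda>z. pick_step (K (hd_data z)) (hd_data (tl_data z)) (tl_data (tl_data z)))"
      unfolding pick_step_def by (intro ptime_intros ptime_inc ptime_compose[OF K])
    \<comment> \<open>The worst case is the accumulator \<open>Leaf\<close>: besides the element,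
      two nodes and a counter of size 2 are new.\<close>
    show "growth (\<lambda>n. q n + 4)"
      by (intro growth_intros q)
    fix d x y
    assume "x \<in> set (l d)"
    then show "size (pick_step (K d) x y) \<le> size y + (q (size d) + 4)"
      using q(2)[of x d] size_inc[of "hd_data y"] size_inc[of Leaf]
      by (cases y) (auto simp: pick_step_def)
  qed (rule ptime_const)
  then show ?thesis
    unfolding pick_def by (intro ptime_tl) simp
qed

text \<open>Only membership in the picked list is read off, so its reversed order does not
  matter.\<close>

definition pad_data :: "data list \<Rightarrow> data \<Rightarrow> data \<Rightarrow> data" where
  "pad_data vs K c = enc_list (map (\<lambda>y. enc_bool (\<exists>x\<in>set (dec_list (pick K
     (filter (\<lambda>y. has_bit y c) vs @ filter (\<lambda>y. \<not> has_bit y c) vs))). x = y)) vs)"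

lemma pad_data_indices:
  assumes "\<And>y. y < n \<Longrightarrow> has_bit (unary y) c \<longleftrightarrow> y \<in> U"
  shows "pad_data (map unary [0..<n]) (enc_nat k) c = enc_set n (pad n k U)"
proof -
  have "filter (\<lambda>y. has_bit y c) (map unary [0..<n]) = map unary (filter (\<lambda>y. y \<in> U) [0..<n])"
    "filter (\<lambda>y. \<not> has_bit y c) (map unary [0..<n]) = map unary (filter (\<lambda>y. y \<notin> U) [0..<n])"
    unfolding filter_map comp_def
    by (intro arg_cong[where f = "map unary"] filter_cong refl; use assms in auto)+
  then have "pad_data (map unary [0..<n]) (enc_nat k) c =
      enc_list (map (\<lambda>y. enc_bool (\<exists>x\<in>set (dec_list (pick (enc_nat k) (map unary
        (filter (\<lambda>x. x \<in> U) [0..<n] @ filter (\<lambda>x. x \<notin> U) [0..<n])))). x = y)) (map unary [0..<n]))"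
    by (simp only: pad_data_def map_append)
  then show ?thesis
    unfolding pick_enc_nat dec_enc_list set_rev take_map
    by (simp add: enc_set_def pad_def comp_def inj_image_mem_iff inj_def del: take_append)
qed

definition improve_data :: "data list \<Rightarrow> data list \<Rightarrow> data \<Rightarrow> data \<Rightarrow> data \<Rightarrow> data" where
  "improve_data vs es K e W =
     (if \<exists>e'\<in>set es. \<forall>y\<in>set vs. has_bit y e' \<longrightarrow> has_bit y W then W else pad_data vs K e)"

definition solution :: "data \<Rightarrow> data \<Rightarrow> data" where
  "solution d R = fold (improve_data (indices (vertices d)) (edges d) (budget d)) (edges d)
     (pad_data (indices (vertices d)) (budget d) R)"

text \<open>Only the first \<open>n\<close> of the \<open>N\<close> bits are ever read, so the
  hyperedge copies in \<open>S\<close> are discarded implicitly.\<close>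

lemma solution_enc_hypergraph:
  assumes es: "\<Union>(set es) \<subseteq> {..<n}" and "n \<le> N"
  shows "solution (enc_hypergraph n es k) (enc_set N S) =
     enc_set n (fold (improve n k es) es (pad n k S))"
proof -
  have step: "improve_data (map unary [0..<n]) (map (enc_set n) es) (enc_nat k) (enc_set n e) (enc_set n W) =
      enc_set n (improve n k es e W)" for e W
  proof -
    have "(\<forall>y\<in>set (map unary [0..<n]). has_bit y (enc_set n e') \<longrightarrow> has_bit y (enc_set n W)) \<longleftrightarrow> e' \<subseteq> W"
      if "e' \<in> set es" for e'
      using es that by (auto simp: bit_enc_set subset_iff)
    moreover have "pad_data (map unary [0..<n]) (enc_nat k) (enc_set n e) = enc_set n (pad n k e)"
      by (rule pad_data_indices) (simp add: bit_enc_set)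
    ultimately show ?thesis
      by (simp add: improve_data_def improve_def)
  qed
  have "fold (improve_data (map unary [0..<n]) (map (enc_set n) es) (enc_nat k)) (map (enc_set n) xs) (enc_set n W)
      = enc_set n (fold (improve n k es) xs W)" for xs W
    by (induction xs arbitrary: W) (simp_all add: step)
  moreover have "pad_data (map unary [0..<n]) (enc_nat k) (enc_set N S) = enc_set n (pad n k S)"
    by (rule pad_data_indices) (use \<open>n \<le> N\<close> in \<open>simp add: bit_enc_set\<close>)
  ultimately show ?thesis
    by (simp add: solution_def hypergraph_data indices_def)
qed

lemma ptime_pad_data:
  assumes "ptime (\<lambda>d. enc_list (vs d))" "ptime K" "ptime c"
  shows "ptime (\<lambda>d. pad_data (vs d) (K d) (c d))"
  unfolding pad_data_def
  by (intro ptime_intros ptime_pick assms ptime_compose[OF assms(2)] ptime_compose[OF assms(3)]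
      ptime_compose[where f = "\<lambda>d. enc_list (vs d)", OF assms(1)])

text \<open>A step keeps the candidate or replaces it by a padded hyperedge whose size does not
  depend on the candidate; hence the additive bound.\<close>

lemma ptime_solution: "ptime (\<lambda>z. solution (hd_data z) (tl_data z))"
proof -
  let ?vs = "\<lambda>d. indices (vertices d)"
  have pad: "ptime (\<lambda>z. pad_data (?vs (hd_data z)) (budget (hd_data z)) (tl_data z))"
    unfolding vertices_def budget_def by (intro ptime_intros ptime_pad_data)
  have edges: "ptime (\<lambda>z. enc_list (edges (hd_data z)))"
    unfolding edges_def by (intro ptime_intros)
  obtain q where q: "growth q" "\<And>z e. e \<in> set (edges (hd_data z)) \<Longrightarrow>
      size (pad_data (?vs (hd_data z)) (budget (hd_data z)) e) \<le> q (size z)"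
  proof (rule ptime_size_bound2[OF _ edges])
    show "ptime (\<lambda>z. pad_data (?vs (hd_data (hd_data z))) (budget (hd_data (hd_data z))) (tl_data z))"
      unfolding vertices_def budget_def by (intro ptime_intros ptime_pad_data)
  qed (rule that)
  have "ptime (\<lambda>z. fold (\<lambda>e W. improve_data (?vs (hd_data z)) (edges (hd_data z)) (budget (hd_data z)) e W)
      (edges (hd_data z)) (pad_data (?vs (hd_data z)) (budget (hd_data z)) (tl_data z)))"
  proof (rule ptime_fold_additive[OF _ edges pad q(1)])
    show "ptime (\<lambda>z. improve_data (?vs (hd_data (hd_data z))) (edges (hd_data (hd_data z)))
        (budget (hd_data (hd_data z))) (hd_data (tl_data z)) (tl_data (tl_data z)))"
      unfolding improve_data_def vertices_def budget_def edges_def by (intro ptime_intros ptime_pad_data)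
    show "size (improve_data (?vs (hd_data z)) (edges (hd_data z)) (budget (hd_data z)) e W)
        \<le> size W + q (size z)" if "e \<in> set (edges (hd_data z))" for z e W
      using q(2)[OF that] by (simp add: improve_data_def)
  qed
  then show ?thesis
    by (simp add: solution_def)
qed

theorem theorem13:
  fixes \<alpha> :: "nat \<Rightarrow> real"
  assumes "\<And>n. \<alpha> n > 0" and "mono \<alpha>"
    and "\<exists>c. knapsack_approximation c \<alpha>"
  shows "\<exists>c. densest_subhypergraph_approximation c (\<lambda>n' m'. 2 * \<alpha> (n' * (m' + 1)))"
proof -
  obtain c where c: "knapsack_approximation c \<alpha>"
    using assms(3) by blast
  then obtain p :: "nat poly" where p: "\<And>n r f w B Or. knapsack_instance {..<n} r f w \<Longrightarrow> value_oracle n r f Or \<Longrightarrow>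
       \<exists>t S. computes Or c (enc_knapsack n r w B) t (enc_set n S) \<and>
              t \<le> poly p (size (enc_knapsack n r w B) + max_answer_size n r Or) \<and>
              approx_solution (\<alpha> n) (knapsack_feasible {..<n} r w B) f S"
    unfolding knapsack_approximation_def by blast
  obtain q where q: "growth q" "\<And>d. size (reduction d) \<le> q (size d)"
    by (rule ptime_size_bound[OF ptime_reduction]) (rule that)
  \<comment> \<open>\<open>q\<close> bounds the reduced instance and thereby the number of its
    elements; an oracle answer has size at most twice that number plus 3.\<close>
  define P where "P n = poly p (q n + (2 * q n + 3))" for n
  \<comment> \<open>A bit vector has size at most twice its length, here the number of poset
    elements.\<close>
  define R where "R n = 2 * q n" for n
  have poly: "growth (poly p)"
    by (auto simp: growth_def)
  have "growth P" "growth R"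
    unfolding P_def R_def by (intro growth_compose[OF poly] growth_intros q)+
  from oracle_free_pipeline[OF ptime_reduction ptime_solution ptime_card_oracle size_card_oracle this, of c]
  obtain c' p' where c': "oracle_free c'" "growth p'" and run: "\<And>d t out. computes card_oracle c (reduction d) t out \<Longrightarrow>
      t \<le> P (size d) \<Longrightarrow> size out \<le> R (size d) \<Longrightarrow>
      \<exists>t' \<le> p' (size d). computes (\<lambda>_. Leaf) c' d t' (solution d out)"
    by blast
  have "\<exists>t U. computes (\<lambda>_. Leaf) c' (enc_hypergraph n es k) t (enc_set n U) \<and>
      t \<le> p' (size (enc_hypergraph n es k)) \<and>
      approx_solution (2 * \<alpha> (n * (card E + 1))) (subhypergraph_feasible {..<n} k)
        (\<lambda>U. real (card (induced_edges E U))) U"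
    if "hypergraph {..<n} E" "set es = E" "distinct es" "k \<le> n" for n E es k
  proof -
    let ?d = "enc_hypergraph n es k" and ?N = "length (labels n es)"
    have es: "\<Union>(set es) \<subseteq> {..<n}"
      using that(1,2) by (auto simp: hypergraph_def)
    \<comment> \<open>Distinctness makes the size of the poset exactly the argument of \<alpha> in
      the claim.\<close>
    have N: "?N = n * (card E + 1)"
      using that(2,3) by (auto simp: length_labels distinct_card)
    have "knapsack_instance {..<?N} (edge_order n es) (\<lambda>S. real (card S)) (vertex_weight n)"
      by (intro knapsack_instance_card partial_order_edge_order es) (auto simp: vertex_weight_def)
    from p[OF this value_oracle_card, of k] obtain t S where
      S: "computes card_oracle c (reduction ?d) t (enc_set ?N S)"
        "t \<le> poly p (size (reduction ?d) + max_answer_size ?N (edge_order n es) card_oracle)"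
        "approx_solution (\<alpha> ?N) (knapsack_feasible {..<?N} (edge_order n es) (vertex_weight n) k)
           (\<lambda>S. real (card S)) S"
      unfolding reduction_enc_hypergraph[OF es] by blast
    have Nq: "?N \<le> q (size ?d)"
      using length_le_size_enc_knapsack[of ?N "edge_order n es" "vertex_weight n" k] q(2)[of ?d]
      by (simp add: reduction_enc_hypergraph[OF es])
    have "t \<le> P (size ?d)"
      unfolding P_def
      by (rule order_trans[OF S(2) growth_mono[OF poly]])
        (use q(2)[of ?d] max_answer_size_card[of ?N "edge_order n es"] Nq in linarith)
    moreover have "size (enc_set ?N S) \<le> R (size ?d)"
      using size_enc_set[of ?N S] Nq by (simp add: R_def)
    ultimately obtain t' where t': "t' \<le> p' (size ?d)"
      "computes (\<lambda>_. Leaf) c' ?d t' (solution ?d (enc_set ?N S))"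
      using run[OF S(1)] by blast
    have "solution ?d (enc_set ?N S) = enc_set n (fold (improve n k es) es (pad n k S))"
      by (rule solution_enc_hypergraph[OF es]) (simp add: length_labels)
    moreover have "approx_solution (2 * \<alpha> ?N) (subhypergraph_feasible {..<n} k)
       (\<lambda>U. real (card (induced_edges (set es) U))) (fold (improve n k es) es (pad n k S))"
      by (rule approx_solution_improve[OF es that(3,4) assms(1) knapsack_approximation_ge_1[OF c assms(1)] S(3)])
    ultimately show ?thesis
      using t' that(2) by (metis N)
  qed
  moreover obtain p'' :: "nat poly" where "p' = poly p''"
    using c'(2) by (auto simp: growth_def)
  ultimately show ?thesis
    unfolding densest_subhypergraph_approximation_def using c'(1) by blast
qed

end
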